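(* The explicit 6-stage Runge--Kutta method with tableau $$\begin{array}{c|cccccc} 0\\ \frac14 & \frac14\\ \frac12 & -\frac12 & 1\\ \frac34 & \frac3{16} & 0 & \frac9{16}\\ \frac3{10} & \frac{291}{2500} & \frac{108}{625} & \frac{63}{2500} & -\frac{9}{625}\\ 1 & -\frac{146}{135} & \frac{152}{15} & -\frac{7}{15} & \frac{428}{405} & -\frac{700}{81}\\ \hline & \frac5{54} & 0 & 0 & \frac{32}{81} & \frac{250}{567} & \frac1{14} \end{array}$$ is of order $5$ for scalar non-autonomous problems $y'(x)=f(y(x),x)$, $y(x)\in\mathbb{R}$, but only of order $4$ (that is, of order $4$ and not of order $5$) for vector problems $\mathbf{y}'(x)=\mathbf{f}(\mathbf{y}(x))$, $\mathbf{y}(x)\in\mathbb{R}^d$, $d\ge1$ arbitrary.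
   Context: A tableau lists $c_i$ in the left column, the entries $a_{ij}$ (zero where blank) in the body, and $b_i$ in the bottom row. For $y'(x)=f(y(x),x)$, $y(x_0)=y_0$, the method with step size $h$ produces $y_1=y_0+h\sum_i b_i f(Y_i,x_0+c_ih)$, where $Y_i=y_0+h\sum_{j<i}a_{ij}f(Y_j,x_0+c_jh)$. For autonomous problems the second argument of $f$ is absent. The method is of order $p$ for scalar problems if, for every $C^\infty$ function $f$ defined near $(y_0,x_0)\in\mathbb{R}\times\mathbb{R}$, $y_1-y(x_0+h)=O(h^{p+1})$ as $h\to0$. It is of order $p$ for vector problems if, for every $d\ge1$ and every $C^\infty$ function $\mathbf{f}$ defined near $\mathbf{y}_0\in\mathbb{R}^d$ with values in $\mathbb{R}^d$, $\mathbf{y}_1-\mathbf{y}(x_0+h)=O(h^{p+1})$ as $h\to0$. *)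

theory Defs
  imports "HOL-Analysis.Analysis" "HOL-Library.Landau_Symbols"
begin

text \<open>
  Since the dimension \<open>d\<close> is quantified inside the notion of order, a point of \<open>\<real>\<^sup>d\<close> is an element of
  \<open>topspace (Euclidean_space d)\<close>: a function on \<open>nat\<close> that vanishes at all indices \<open>\<ge> d\<close>. The
  topology is the product topology, so the type-class predicate \<open>continuous_on\<close> has its usual
  meaning on subsets of \<open>\<real>\<^sup>d\<close>.
\<close>

definition partial_deriv :: "nat \<Rightarrow> ((nat \<Rightarrow> real) \<Rightarrow> real) \<Rightarrow> (nat \<Rightarrow> real) \<Rightarrow> real" where
  "partial_deriv i g v = deriv (\<lambda>t. g (v(i := t))) (v i)"

primrec Ck_on :: "nat \<Rightarrow> nat \<Rightarrow> (nat \<Rightarrow> real) set \<Rightarrow> ((nat \<Rightarrow> real) \<Rightarrow> real) \<Rightarrow> bool" where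
  "Ck_on d 0 U g \<longleftrightarrow> continuous_on U g"
| "Ck_on d (Suc k) U g \<longleftrightarrow> continuous_on U g \<and>
     (\<forall>i<d. (\<forall>v\<in>U. (\<lambda>t. g (v(i := t))) field_differentiable (at (v i))) \<and>
            Ck_on d k U (partial_deriv i g))"

text \<open>Intended for \<open>U\<close> open in \<open>\<real>\<^sup>d\<close>.\<close>

definition Cinf_on :: "nat \<Rightarrow> (nat \<Rightarrow> real) set \<Rightarrow> ((nat \<Rightarrow> real) \<Rightarrow> real) \<Rightarrow> bool" where
  "Cinf_on d U g \<longleftrightarrow> (\<forall>k. Ck_on d k U g)"

text \<open>
  An explicit method is given by the list \<open>A\<close> of the rows of the strictly lower triangular part
  (row \<open>i\<close> has length \<open>i\<close>, counting from \<open>0\<close>), the weights \<open>b\<close> and the nodes \<open>c\<close>. All indices are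
  shifted to start at \<open>0\<close>.
\<close>

fun rk_stage :: "real list list \<Rightarrow> real list \<Rightarrow> (real \<Rightarrow> real \<Rightarrow> real) \<Rightarrow> real \<Rightarrow> real \<Rightarrow> real \<Rightarrow> nat \<Rightarrow> real"
  where
  "rk_stage A c f y0 x0 h i =
     y0 + h * (\<Sum>j<i. A ! i ! j * f (rk_stage A c f y0 x0 h j) (x0 + c ! j * h))"

definition rk_step ::
  "real list list \<Rightarrow> real list \<Rightarrow> real list \<Rightarrow> (real \<Rightarrow> real \<Rightarrow> real) \<Rightarrow> real \<Rightarrow> real \<Rightarrow> real \<Rightarrow> real" where
  "rk_step A b c f y0 x0 h =
     y0 + h * (\<Sum>i<length b. b ! i * f (rk_stage A c f y0 x0 h i) (x0 + c ! i * h))"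

fun rk_stage_vec ::
  "real list list \<Rightarrow> ((nat \<Rightarrow> real) \<Rightarrow> nat \<Rightarrow> real) \<Rightarrow> (nat \<Rightarrow> real) \<Rightarrow> real \<Rightarrow> nat \<Rightarrow> nat \<Rightarrow> real" where
  "rk_stage_vec A f y0 h i =
     (\<lambda>m. y0 m + h * (\<Sum>j<i. A ! i ! j * f (rk_stage_vec A f y0 h j) m))"

definition rk_step_vec ::
  "real list list \<Rightarrow> real list \<Rightarrow> ((nat \<Rightarrow> real) \<Rightarrow> nat \<Rightarrow> real) \<Rightarrow> (nat \<Rightarrow> real) \<Rightarrow> real \<Rightarrow> nat \<Rightarrow> real" where
  "rk_step_vec A b f y0 h =
     (\<lambda>m. y0 m + h * (\<Sum>i<length b. b ! i * f (rk_stage_vec A f y0 h i) m))"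

declare rk_stage.simps [simp del] rk_stage_vec.simps [simp del]

text \<open>Both \<open>f\<close> and \<open>y\<close> are total functions, of which only the values on \<open>U\<close> and on the interval
  \<open>ball x0 \<epsilon>\<close> matter. The germ at \<open>x0\<close> of a solution \<open>y\<close> exists and is unique.\<close>

definition rk_order_scalar :: "real list list \<Rightarrow> real list \<Rightarrow> real list \<Rightarrow> nat \<Rightarrow> bool" where
  "rk_order_scalar A b c p \<longleftrightarrow>
     (\<forall>(U :: (real \<times> real) set) f y0 x0 y \<epsilon>.
        open U \<and> (y0, x0) \<in> U \<and>
        Cinf_on 2 {v \<in> topspace (Euclidean_space 2). (v 0, v 1) \<in> U} (\<lambda>v. f (v 0) (v 1)) \<and>
        \<epsilon> > 0 \<and> y x0 = y0 \<and>
        (\<forall>x\<in>ball x0 \<epsilon>. (y x, x) \<in> U \<and> (y has_real_derivative f (y x) x) (at x))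
        \<longrightarrow> (\<lambda>h. rk_step A b c f y0 x0 h - y (x0 + h)) \<in> O[at 0](\<lambda>h. h ^ (p + 1)))"

definition rk_order_vector :: "real list list \<Rightarrow> real list \<Rightarrow> nat \<Rightarrow> bool" where
  "rk_order_vector A b p \<longleftrightarrow>
     (\<forall>d\<ge>1. \<forall>U f y0 x0 y \<epsilon>.
        openin (Euclidean_space d) U \<and> y0 \<in> U \<and>
        f \<in> U \<rightarrow> topspace (Euclidean_space d) \<and>
        (\<forall>m<d. Cinf_on d U (\<lambda>v. f v m)) \<and>
        \<epsilon> > 0 \<and> y x0 = y0 \<and>
        (\<forall>x\<in>ball x0 \<epsilon>. y x \<in> U \<and>
           (\<forall>m<d. ((\<lambda>t. y t m) has_real_derivative f (y x) m) (at x)))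
        \<longrightarrow> (\<lambda>h. L2_set (\<lambda>m. rk_step_vec A b f y0 h m - y (x0 + h) m) {..<d})
              \<in> O[at 0](\<lambda>h. h ^ (p + 1)))"

definition method_A :: "real list list" where
  "method_A =
     [[],
      [1/4],
      [-1/2, 1],
      [3/16, 0, 9/16],
      [291/2500, 108/625, 63/2500, -9/625],
      [-146/135, 152/15, -7/15, 428/405, -700/81]]"

definition method_b :: "real list" where
  "method_b = [5/54, 0, 0, 32/81, 250/567, 1/14]"

definition method_c :: "real list" where
  "method_c = [0, 1/4, 1/2, 3/4, 3/10, 1]"

end

theory Submission
  imports Defs "HOL-Computational_Algebra.Polynomial"
begin

text \<open>
  Let \<open>z\<^sub>i = y(x\<^sub>0 + c\<^sub>i h)\<close> and let \<open>E\<^sub>i = z\<^sub>i - Y\<^sub>i\<close> be the stage errors (following Albrecht). They satisfy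
  \<open>E\<^sub>i = d\<^sub>i + h \<Sum>\<^sub>j a\<^sub>i\<^sub>j (f(z\<^sub>j) - f(Y\<^sub>j))\<close>, where \<open>d\<^sub>i\<close> is the defect of a quadrature rule applied to \<open>y'\<close>,
  and \<open>f(z\<^sub>j) - f(Y\<^sub>j) = J(x\<^sub>0 + c\<^sub>j h) E\<^sub>j + O(|E\<^sub>j|\<^sup>2)\<close> with \<open>J\<close> the Jacobian of \<open>f\<close> along \<open>y\<close>. Here every
  \<open>E\<^sub>i\<close> is \<open>O(h\<^sup>2)\<close>, and \<open>O(h\<^sup>3)\<close> for the stages of non-zero weight, so to the required order the
  quadratic terms drop out and the recursion for the \<open>E\<^sub>i\<close> is linear. At \<open>h\<^sup>5\<close> the terms in \<open>J J' y''\<close> and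
  \<open>J' J y''\<close> have opposite non-zero coefficients: they cancel for scalar \<open>J\<close>, but not for matrices.
\<close>

section \<open>Taylor polynomials at \<open>0\<close>\<close>

text \<open>The filter is \<open>nhds 0\<close> and not \<open>at 0\<close> so that \<open>u (c * h)\<close> may be expanded also when \<open>c = 0\<close>.\<close>

definition taylor_upto :: "nat \<Rightarrow> (real \<Rightarrow> real) \<Rightarrow> real poly \<Rightarrow> bool" where
  "taylor_upto n u p \<longleftrightarrow> (\<lambda>h. u h - poly p h) \<in> O[nhds 0](\<lambda>h. h ^ n)"

lemma isCont_tendsto_nhds:
  assumes "isCont f a"
  shows "(f \<longlongrightarrow> f a) (nhds a)"
  using isContD[OF assms] tendsto_at_iff_tendsto_nhds[of f a] by blast

lemma power_bigo_nhds_0: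
  assumes "m \<le> n"
  shows "(\<lambda>h::real. h ^ n) \<in> O[nhds 0](\<lambda>h. h ^ m)"
proof (rule bigoI[where c = 1])
  have "eventually (\<lambda>h::real. h \<in> ball 0 1) (nhds 0)"
    by (intro eventually_nhds_in_open) auto
  then show "eventually (\<lambda>h::real. norm (h ^ n) \<le> 1 * norm (h ^ m)) (nhds 0)"
    by eventually_elim (auto simp: power_abs intro!: power_decreasing assms)
qed

lemma bigo_power_nhds_0_mono:
  fixes u :: "real \<Rightarrow> real"
  assumes "u \<in> O[nhds 0](\<lambda>h. h ^ n)" "m \<le> n"
  shows "u \<in> O[nhds 0](\<lambda>h. h ^ m)"
  using assms(1) power_bigo_nhds_0[OF assms(2)] by (rule landau_o.big.trans)

lemma bigo_scale_arg:
  fixes u :: "real \<Rightarrow> real"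
  assumes "u \<in> O[nhds 0](\<lambda>h. h ^ n)"
  shows "(\<lambda>h. u (c * h)) \<in> O[nhds 0](\<lambda>h. h ^ n)"
proof -
  have "isCont (\<lambda>h. c * h) (0::real)" by (intro continuous_intros)
  then have "filterlim (\<lambda>h. c * h) (nhds 0) (nhds (0::real))"
    using isCont_tendsto_nhds[of 0 "\<lambda>h. c * h"] by simp
  from landau_o.big.compose[OF assms this]
  have "(\<lambda>h. u (c * h)) \<in> O[nhds 0](\<lambda>h. (c * h) ^ n)" .
  also have "(\<lambda>h. (c * h) ^ n) \<in> O[nhds 0](\<lambda>h. h ^ n)"
    by (intro bigoI[where c = "\<bar>c\<bar> ^ n"]) (auto simp: power_mult_distrib abs_mult power_abs)
  finally show ?thesis .
qed

text \<open>Mean value inequality on the interval of radius |h| about 0: there \<open>u'\<close> is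
  bounded by a multiple of |h|^n, and the length |h| supplies the extra power.\<close>

lemma bigo_integral:
  fixes u :: "real \<Rightarrow> real"
  assumes "eventually (\<lambda>t. (u has_real_derivative u' t) (at t)) (nhds 0)"
    and "u' \<in> O[nhds 0](\<lambda>h. h ^ n)" and "u 0 = 0"
  shows "u \<in> O[nhds 0](\<lambda>h. h ^ Suc n)"
proof -
  obtain C where C: "eventually (\<lambda>h. norm (u' h) \<le> C * norm (h ^ n)) (nhds 0)"
    using assms(2) by (auto elim: landau_o.bigE)
  from eventually_conj[OF assms(1) C] obtain r where r: "r > 0"
    "\<And>t. dist t 0 < r \<Longrightarrow> (u has_real_derivative u' t) (at t) \<and> norm (u' t) \<le> C * norm (t ^ n)"
    unfolding eventually_nhds_metric by blast
  have "norm (u h) \<le> \<bar>C\<bar> * norm (h ^ Suc n)" if h: "h \<in> ball 0 r" for h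
  proof -
    have sub: "dist t 0 < r" if "t \<in> cball 0 \<bar>h\<bar>" for t :: real
      using that h by (auto simp: dist_commute)
    have "norm (u h - u 0) \<le> (\<bar>C\<bar> * \<bar>h\<bar> ^ n) * norm (h - 0)"
    proof (rule field_differentiable_bound[where S = "cball 0 \<bar>h\<bar>" and f' = u'])
      fix t :: real assume t: "t \<in> cball 0 \<bar>h\<bar>"
      show "(u has_real_derivative u' t) (at t within cball 0 \<bar>h\<bar>)"
        using r(2)[OF sub[OF t]] by (blast intro: has_field_derivative_at_within)
      have "norm (u' t) \<le> C * norm (t ^ n)" using r(2)[OF sub[OF t]] by blast
      also have "\<dots> \<le> \<bar>C\<bar> * \<bar>h\<bar> ^ n"
        using t by (intro mult_mono) (auto simp: power_abs intro!: power_mono)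
      finally show "norm (u' t) \<le> \<bar>C\<bar> * \<bar>h\<bar> ^ n" .
    qed auto
    then show ?thesis using assms(3) by (simp add: power_abs abs_mult mult_ac)
  qed
  moreover have "eventually (\<lambda>h. h \<in> ball 0 r) (nhds 0)"
    using r(1) by (intro eventually_nhds_in_open) auto
  ultimately show ?thesis
    by (intro bigoI[where c = "\<bar>C\<bar>"]) (auto elim: eventually_mono)
qed

lemma poly_bigo_nhds_0: "poly p \<in> O[nhds 0](\<lambda>h::real. h ^ 0)"
proof -
  have "(poly p \<longlongrightarrow> poly p 0) (nhds 0)"
    by (intro isCont_tendsto_nhds poly_isCont)
  then have "poly p \<in> O[nhds 0](\<lambda>_. 1)"
    by (intro bigoI_tendsto[where c = "poly p 0"]) simp_all
  then show ?thesis by simp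
qed

lemma taylor_upto_0_iff: "taylor_upto n u 0 \<longleftrightarrow> u \<in> O[nhds 0](\<lambda>h. h ^ n)"
  by (simp add: taylor_upto_def)

lemma taylor_upto_mono: "taylor_upto n u p \<Longrightarrow> m \<le> n \<Longrightarrow> taylor_upto m u p"
  unfolding taylor_upto_def by (rule bigo_power_nhds_0_mono)

text \<open>The difference of the polynomials is divisible by X^n, with a cofactor bounded near 0.
  Thus the sums, products and compositions built by the rules below can be truncated to explicit
  coefficient lists.\<close>

lemma taylor_upto_cong:
  assumes "taylor_upto n u p" and "\<And>k. k < n \<Longrightarrow> coeff p k = coeff q k"
  shows "taylor_upto n u q"
proof -
  have "monom 1 n dvd p - q" using assms(2) by (simp add: monom_1_dvd_iff')
  then obtain r where r: "p - q = monom 1 n * r" unfolding dvd_def by blast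
  have "(\<lambda>h. h ^ n * poly r h) \<in> O[nhds 0](\<lambda>h. h ^ n * h ^ 0)"
    by (intro landau_o.big.mult poly_bigo_nhds_0) auto
  also have "(\<lambda>h. h ^ n * poly r h) = (\<lambda>h. poly p h - poly q h)"
    using arg_cong[OF r, of poly] by (simp add: fun_eq_iff poly_monom)
  finally have "(\<lambda>h. poly p h - poly q h) \<in> O[nhds 0](\<lambda>h. h ^ n)" by simp
  from sum_in_bigo(1)[OF assms(1)[unfolded taylor_upto_def] this]
  show ?thesis by (simp add: taylor_upto_def)
qed

lemma taylor_upto_bigo:
  assumes "taylor_upto n u p" and "\<And>k. k < n \<Longrightarrow> coeff p k = 0"
  shows "u \<in> O[nhds 0](\<lambda>h. h ^ n)"
  using taylor_upto_cong[OF assms(1), of 0] assms(2) by (simp add: taylor_upto_0_iff)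

lemma taylor_upto_const: "taylor_upto n (\<lambda>_. a) [:a:]"
  by (simp add: taylor_upto_def)

lemma taylor_upto_add:
  assumes "taylor_upto n u p" "taylor_upto n v q"
  shows "taylor_upto n (\<lambda>h. u h + v h) (p + q)"
  using sum_in_bigo(1)[OF assms[unfolded taylor_upto_def]]
  by (simp add: taylor_upto_def algebra_simps)

lemma taylor_upto_diff:
  assumes "taylor_upto n u p" "taylor_upto n v q"
  shows "taylor_upto n (\<lambda>h. u h - v h) (p - q)"
  using sum_in_bigo(2)[OF assms[unfolded taylor_upto_def]]
  by (simp add: taylor_upto_def algebra_simps)

lemma taylor_upto_sum:
  assumes "\<And>i. i \<in> I \<Longrightarrow> taylor_upto n (u i) (p i)"
  shows "taylor_upto n (\<lambda>h. \<Sum>i\<in>I. u i h) (\<Sum>i\<in>I. p i)"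
  using big_sum_in_bigo[of I "\<lambda>i h. u i h - poly (p i) h"] assms
  by (simp add: taylor_upto_def poly_sum sum_subtractf)

text \<open>Splits uv - pq as (u - p)v + p(v - q), where \<open>v\<close> and \<open>p\<close> are
  bounded near 0.\<close>

lemma taylor_upto_mult:
  assumes "taylor_upto n u p" "taylor_upto n v q"
  shows "taylor_upto n (\<lambda>h. u h * v h) (p * q)"
proof -
  have "(\<lambda>h. v h - poly q h) \<in> O[nhds 0](\<lambda>h. h ^ 0)"
    using assms(2) unfolding taylor_upto_def by (rule bigo_power_nhds_0_mono) simp
  from sum_in_bigo(1)[OF this poly_bigo_nhds_0[of q]]
  have "v \<in> O[nhds 0](\<lambda>h. h ^ 0)" by simp
  then have "(\<lambda>h. (u h - poly p h) * v h) \<in> O[nhds 0](\<lambda>h. h ^ n * h ^ 0)"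
    using assms(1) unfolding taylor_upto_def by (intro landau_o.big.mult) auto
  moreover have "(\<lambda>h. poly p h * (v h - poly q h)) \<in> O[nhds 0](\<lambda>h. h ^ 0 * h ^ n)"
    using assms(2) unfolding taylor_upto_def by (intro landau_o.big.mult poly_bigo_nhds_0)
  ultimately have "(\<lambda>h. (u h - poly p h) * v h + poly p h * (v h - poly q h)) \<in> O[nhds 0](\<lambda>h. h ^ n)"
    by (intro sum_in_bigo) simp_all
  then show ?thesis by (simp add: taylor_upto_def algebra_simps)
qed

lemma taylor_upto_cmult: "taylor_upto n u p \<Longrightarrow> taylor_upto n (\<lambda>h. a * u h) (smult a p)"
  using taylor_upto_mult[OF taylor_upto_const[of n a]] by simp

text \<open>This gain of one order is why each pass through the stage equations improves the known
  accuracy by one power of \<open>h\<close>.\<close>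

lemma taylor_upto_shift:
  assumes "taylor_upto n u p"
  shows "taylor_upto (Suc n) (\<lambda>h. h * u h) (pCons 0 p)"
  using landau_o.big.mult_left[OF assms[unfolded taylor_upto_def], of "\<lambda>h. h"]
  by (simp add: taylor_upto_def algebra_simps)

lemma taylor_upto_scale_arg:
  "taylor_upto n u p \<Longrightarrow> taylor_upto n (\<lambda>h. u (c * h)) (p \<circ>\<^sub>p [:0, c:])"
  unfolding taylor_upto_def by (drule bigo_scale_arg) (simp add: poly_pcompose mult.commute)

lemma taylor_upto_integral:
  assumes "eventually (\<lambda>t. (u has_real_derivative u' t) (at t)) (nhds 0)"
    and "taylor_upto n u' (pderiv p)" and "poly p 0 = u 0"
  shows "taylor_upto (Suc n) u p"
  unfolding taylor_upto_def
proof (rule bigo_integral)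
  show "\<forall>\<^sub>F t in nhds 0.
      ((\<lambda>h. u h - poly p h) has_real_derivative u' t - poly (pderiv p) t) (at t)"
    using assms(1) by eventually_elim (auto intro!: derivative_intros)
qed (use assms in \<open>auto simp: taylor_upto_def\<close>)

lemma ex_poly_antiderivative:
  fixes p :: "'a :: field_char_0 poly"
  obtains P where "pderiv P = p" "poly P 0 = a"
proof
  define P where "P = [:a:] + (\<Sum>i\<le>degree p. monom (coeff p i / of_nat (Suc i)) (Suc i))"
  have "pderiv (monom (coeff p i / of_nat (Suc i)) (Suc i)) = monom (coeff p i) i" for i
    using of_nat_neq_0[of i, where 'a = 'a] by (simp add: pderiv_monom del: of_nat_Suc)
  then show "pderiv P = p"
    by (simp add: P_def pderiv_add higher_pderiv_sum[of 1, simplified] poly_as_sum_of_monoms del: of_nat_Suc)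
  show "poly P 0 = a" by (simp add: P_def poly_sum poly_monom)
qed

section \<open>Smooth functions on open subsets of \<open>\<real>\<^sup>d\<close>\<close>

lemma ex_common_radius:
  assumes "\<And>n. n < (d::nat) \<Longrightarrow> \<exists>r>0. P n r"
    and "\<And>n r s. P n r \<Longrightarrow> 0 < s \<Longrightarrow> s \<le> r \<Longrightarrow> P n (s::real)"
  shows "\<exists>r>0. \<forall>n<d. P n r"
  using assms(1)
proof (induction d)
  case 0
  then show ?case by (auto intro: exI[of _ 1])
next
  case (Suc d)
  then obtain r s where "r > 0" "\<forall>n<d. P n r" "s > 0" "P d s" by (meson less_Suc_eq)
  then have "\<forall>n<Suc d. P n (min r s)"
    using assms(2) by (auto simp: less_Suc_eq)
  then show ?case using \<open>r > 0\<close> \<open>s > 0\<close> by (intro exI[of _ "min r s"]) simp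
qed

section \<open>Coordinate boxes as neighbourhoods\<close>

definition box_around :: "nat \<Rightarrow> (nat \<Rightarrow> real) \<Rightarrow> real \<Rightarrow> (nat \<Rightarrow> real) set" where
  "box_around d p r = {v \<in> topspace (Euclidean_space d). \<forall>m<d. \<bar>v m - p m\<bar> < r}"

lemma box_around_mono: "s \<le> r \<Longrightarrow> box_around d p s \<subseteq> box_around d p r"
  by (fastforce simp: box_around_def)

text \<open>A basic open set constrains each coordinate separately. From index \<open>d\<close> on
  both points are zero, so a common radius for the \<open>d\<close> other coordinates
  suffices.\<close>

lemma openin_Euclidean_space_imp_box:
  assumes "openin (Euclidean_space d) U" "p \<in> U"
  shows "\<exists>r>0. box_around d p r \<subseteq> U"
proof -
  from assms(1) obtain T where T: "openin (powertop_real UNIV) T" "U = T \<inter> {x. \<forall>i\<ge>d. x i = 0}"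
    by (auto simp: Euclidean_space_def openin_subtopology)
  have "p \<in> T" using T assms by auto
  from product_topology_open_contains_basis[OF T(1) this] obtain X where
    X: "p \<in> (\<Pi>\<^sub>E i\<in>UNIV. X i)" "\<And>i. open (X i)" "(\<Pi>\<^sub>E i\<in>UNIV. X i) \<subseteq> T"
    by auto
  have "\<exists>r>0. ball (p n) r \<subseteq> X n" for n
    using X(1,2) open_contains_ball by (metis PiE_E UNIV_I)
  then have "\<exists>r>0. \<forall>n<d. ball (p n) r \<subseteq> X n"
    by (intro ex_common_radius) (auto dest: subset_ball)
  then obtain r where r: "r > 0" "\<And>n. n < d \<Longrightarrow> ball (p n) r \<subseteq> X n" by blast
  have "v \<in> U" if v: "v \<in> box_around d p r" for v
  proof -
    have "v n \<in> X n" for n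
    proof (cases "n < d")
      case True
      then have "v n \<in> ball (p n) r"
        using v by (auto simp: box_around_def dist_real_def abs_minus_commute)
      with r(2)[OF True] show ?thesis by blast
    next
      case False
      then have "v n = 0" "p n = 0"
        using v assms(2) T by (auto simp: box_around_def topspace_Euclidean_space)
      with X(1) show ?thesis by (metis PiE_E UNIV_I)
    qed
    then have "v \<in> T" using X(3) by auto
    with v T show ?thesis by (auto simp: box_around_def topspace_Euclidean_space)
  qed
  with r(1) show ?thesis by blast
qed

text \<open>The preimage of a ball is open relative to \<open>U\<close>, hence open in R^d because
  \<open>U\<close> is, and so contains a box.\<close>

lemma continuous_on_imp_box:
  fixes g :: "(nat \<Rightarrow> real) \<Rightarrow> real"
  assumes "openin (Euclidean_space d) U" "p \<in> U" "continuous_on U g" "e > 0"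
  shows "\<exists>r>0. \<forall>v\<in>box_around d p r. \<bar>g v - g p\<bar> < e"
proof -
  have sub: "U \<subseteq> topspace (Euclidean_space d)" using assms(1) openin_subset by blast
  have "openin (top_of_set U) (U \<inter> g -` ball (g p) e)"
    using assms(3) by (intro continuous_openin_preimage_gen) auto
  moreover have "top_of_set U = subtopology (Euclidean_space d) U"
    using sub by (simp add: Euclidean_space_def euclidean_product_topology subtopology_subtopology
        topspace_Euclidean_space Int_absorb1)
  ultimately have "openin (Euclidean_space d) (U \<inter> g -` ball (g p) e)"
    using assms(1) openin_trans_full by metis
  from openin_Euclidean_space_imp_box[OF this, of p] assms(2,4) show ?thesis
    by (fastforce simp: dist_real_def abs_minus_commute)
qed

text \<open>The increment from \<open>v\<close> to \<open>u\<close> is telescoped along the points that agree with \<open>u\<close> in the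
  first \<open>k\<close> coordinates and with \<open>v\<close> in the others.\<close>

lemma partial_deriv_increment_bound:
  assumes "u \<in> topspace (Euclidean_space d)" "v \<in> topspace (Euclidean_space d)"
    and diff: "\<And>w n. w \<in> topspace (Euclidean_space d) \<Longrightarrow>
        (\<forall>m<d. w m \<in> closed_segment (u m) (v m)) \<Longrightarrow> n < d \<Longrightarrow>
        (\<lambda>t. g (w(n := t))) field_differentiable (at (w n))"
    and bound: "\<And>w n. w \<in> topspace (Euclidean_space d) \<Longrightarrow>
        (\<forall>m<d. w m \<in> closed_segment (u m) (v m)) \<Longrightarrow> n < d \<Longrightarrow>
        \<bar>partial_deriv n g w - c n\<bar> \<le> e"
  shows "\<bar>g u - g v - (\<Sum>n<d. c n * (u n - v n))\<bar> \<le> e * (\<Sum>n<d. \<bar>u n - v n\<bar>)"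
proof -
  define W where "W k = (\<lambda>n. if n < k then u n else v n)" for k
  have W0: "W 0 = v" and Wd: "W d = u"
    using assms(1,2) by (auto simp: W_def topspace_Euclidean_space fun_eq_iff)
  have step: "\<bar>g (W (Suc k)) - g (W k) - c k * (u k - v k)\<bar> \<le> e * \<bar>u k - v k\<bar>" if k: "k < d" for k
  proof -
    define S where "S = closed_segment (u k) (v k)"
    define \<phi> where "\<phi> t = g ((W k)(k := t)) - c k * t" for t
    have "norm (\<phi> (u k) - \<phi> (v k)) \<le> e * norm (u k - v k)"
    proof (rule field_differentiable_bound[where S = S
          and f' = "\<lambda>t. partial_deriv k g ((W k)(k := t)) - c k"])
      fix t assume t: "t \<in> S"
      define w where "w = (W k)(k := t)"
      have w: "w \<in> topspace (Euclidean_space d)" "\<forall>m<d. w m \<in> closed_segment (u m) (v m)"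
        using t k assms(1,2) by (auto simp: w_def W_def S_def topspace_Euclidean_space)
      have "((\<lambda>t. g (w(k := t))) has_field_derivative partial_deriv k g w) (at (w k))"
        using diff[OF w k] unfolding partial_deriv_def by (simp add: DERIV_deriv_iff_field_differentiable)
      then have "((\<lambda>t. g ((W k)(k := t))) has_field_derivative partial_deriv k g w) (at t)"
        by (simp add: w_def)
      then have "(\<phi> has_field_derivative partial_deriv k g w - c k) (at t)"
        unfolding \<phi>_def by (auto intro!: derivative_eq_intros)
      then show "(\<phi> has_field_derivative partial_deriv k g ((W k)(k := t)) - c k) (at t within S)"
        by (simp add: w_def has_field_derivative_at_within)
      show "norm (partial_deriv k g ((W k)(k := t)) - c k) \<le> e"
        using bound[OF w k] unfolding w_def real_norm_def .
    qed (auto simp: S_def)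
    moreover have "(W k)(k := u k) = W (Suc k)" "(W k)(k := v k) = W k"
      by (auto simp: W_def fun_eq_iff)
    ultimately show ?thesis by (simp add: \<phi>_def algebra_simps)
  qed
  have "g u - g v - (\<Sum>n<d. c n * (u n - v n))
      = (\<Sum>k<d. g (W (Suc k)) - g (W k) - c k * (u k - v k))"
    using sum_lessThan_telescope[of "\<lambda>k. g (W k)" d] by (simp add: sum_subtractf W0 Wd)
  also have "\<bar>\<dots>\<bar> \<le> (\<Sum>k<d. e * \<bar>u k - v k\<bar>)"
    by (rule order_trans[OF sum_abs]) (auto intro!: sum_mono step)
  finally show ?thesis by (simp add: sum_distrib_left)
qed

section \<open>First and second order estimates for smooth functions\<close>

lemma Cinf_onD:
  assumes "Cinf_on d U g"
  shows "continuous_on U g"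
    and "i < d \<Longrightarrow> v \<in> U \<Longrightarrow> (\<lambda>t. g (v(i := t))) field_differentiable (at (v i))"
    and "i < d \<Longrightarrow> Cinf_on d U (partial_deriv i g)"
proof -
  have "Ck_on d 0 U g" "Ck_on d (Suc 0) U g" "\<And>k. Ck_on d (Suc k) U g"
    using assms unfolding Cinf_on_def by blast+
  then show "continuous_on U g"
    and "i < d \<Longrightarrow> v \<in> U \<Longrightarrow> (\<lambda>t. g (v(i := t))) field_differentiable (at (v i))"
    and "i < d \<Longrightarrow> Cinf_on d U (partial_deriv i g)"
    by (auto simp: Cinf_on_def)
qed

lemma segment_in_box_around:
  assumes "u \<in> box_around d p r" "v \<in> box_around d p r"
    and "w \<in> topspace (Euclidean_space d)" "\<forall>m<d. w m \<in> closed_segment (u m) (v m)"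
  shows "w \<in> box_around d p r"
proof -
  have "w m \<in> ball (p m) r" if "m < d" for m
  proof -
    have "closed_segment (u m) (v m) \<subseteq> ball (p m) r"
      using assms(1,2) that
      by (intro closed_segment_subset) (auto simp: box_around_def dist_real_def abs_minus_commute)
    then show ?thesis using assms(4) that by blast
  qed
  then show ?thesis
    using assms(3) by (auto simp: box_around_def dist_real_def abs_minus_commute)
qed

text \<open>Continuity bounds all partial derivatives by one constant on a small box; the increment
  bound is then used with every \<open>c n\<close> equal to 0.\<close>

lemma Cinf_on_locally_lipschitz:
  assumes "openin (Euclidean_space d) U" "p \<in> U" "Cinf_on d U g"
  shows "\<exists>r>0. box_around d p r \<subseteq> U \<and> (\<exists>L\<ge>0. \<forall>u\<in>box_around d p r. \<forall>v\<in>box_around d p r.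
           \<bar>g u - g v\<bar> \<le> L * (\<Sum>n<d. \<bar>u n - v n\<bar>))"
proof -
  \<comment> \<open>The \<open>+ 1\<close> absorbs the variation of a partial derivative over the
    box, and the sum dominates each of its terms.\<close>
  define L where "L = (\<Sum>n<d. \<bar>partial_deriv n g p\<bar> + 1)"
  have "\<exists>r>0. \<forall>v\<in>box_around d p r. \<bar>partial_deriv n g v\<bar> \<le> L" if n: "n < d" for n
  proof -
    obtain r where r: "r > 0" "\<And>v. v \<in> box_around d p r \<Longrightarrow> \<bar>partial_deriv n g v - partial_deriv n g p\<bar> < 1"
      using continuous_on_imp_box[OF assms(1,2) Cinf_onD(1)[OF Cinf_onD(3)[OF assms(3) n]], of 1]
      by auto
    have "\<bar>partial_deriv n g p\<bar> + 1 \<le> L"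
      unfolding L_def by (rule member_le_sum) (use n in auto)
    then have "\<bar>partial_deriv n g v\<bar> \<le> L" if "v \<in> box_around d p r" for v
      using r(2)[OF that] by linarith
    with r(1) show ?thesis by blast
  qed
  then have "\<exists>r>0. \<forall>n<d. \<forall>v\<in>box_around d p r. \<bar>partial_deriv n g v\<bar> \<le> L"
    by (intro ex_common_radius) (blast dest: box_around_mono)+
  then obtain r1 where r1: "r1 > 0"
    "\<And>n v. n < d \<Longrightarrow> v \<in> box_around d p r1 \<Longrightarrow> \<bar>partial_deriv n g v\<bar> \<le> L" by blast
  obtain r2 where r2: "r2 > 0" "box_around d p r2 \<subseteq> U"
    using openin_Euclidean_space_imp_box[OF assms(1,2)] by blast
  define r where "r = min r1 r2"
  have r: "r > 0" "box_around d p r \<subseteq> U"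
    using r1 r2 box_around_mono[of r r2 d p] by (auto simp: r_def)
  have "\<bar>g u - g v\<bar> \<le> L * (\<Sum>n<d. \<bar>u n - v n\<bar>)"
    if uv: "u \<in> box_around d p r" "v \<in> box_around d p r" for u v
  proof -
    have "\<bar>g u - g v - (\<Sum>n<d. 0 * (u n - v n))\<bar> \<le> L * (\<Sum>n<d. \<bar>u n - v n\<bar>)"
    proof (rule partial_deriv_increment_bound)
      fix w n assume "w \<in> topspace (Euclidean_space d)"
        "\<forall>m<d. w m \<in> closed_segment (u m) (v m)" and n: "n < d"
      then have w: "w \<in> box_around d p r" by (intro segment_in_box_around[OF uv])
      show "(\<lambda>t. g (w(n := t))) field_differentiable (at (w n))"
        using Cinf_onD(2)[OF assms(3) n] w r(2) by blast
      show "\<bar>partial_deriv n g w - 0\<bar> \<le> L"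
        using r1(2)[OF n] w box_around_mono[of r r1 d p] by (auto simp: r_def)
    qed (use uv in \<open>auto simp: box_around_def\<close>)
    then show ?thesis by simp
  qed
  moreover have "L \<ge> 0" by (auto simp: L_def intro: sum_nonneg)
  ultimately show ?thesis using r by blast
qed

text \<open>The partial derivatives are themselves locally Lipschitz, so between \<open>u\<close>
  and \<open>v\<close> they differ from their values at \<open>v\<close> by a multiple of the
  distance. The increment bound with those values as \<open>c n\<close> squares the
  distance.\<close>

lemma Cinf_on_local_second_order:
  assumes "openin (Euclidean_space d) U" "p \<in> U" "Cinf_on d U g"
  shows "\<exists>r>0. box_around d p r \<subseteq> U \<and> (\<exists>L\<ge>0. \<forall>u\<in>box_around d p r. \<forall>v\<in>box_around d p r.
           \<bar>g u - g v - (\<Sum>n<d. partial_deriv n g v * (u n - v n))\<bar> \<le> L * (\<Sum>n<d. \<bar>u n - v n\<bar>)\<^sup>2)"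
proof -
  define lip where "lip n L r \<longleftrightarrow> (\<forall>u\<in>box_around d p r. \<forall>v\<in>box_around d p r.
      \<bar>partial_deriv n g u - partial_deriv n g v\<bar> \<le> L * (\<Sum>m<d. \<bar>u m - v m\<bar>))" for n L r
  have lip_mono: "lip n L s" if "lip n L r" "s \<le> r" for n L r s
    using that box_around_mono[of s r d p] by (auto simp: lip_def)
  have "\<exists>r>0. \<exists>L\<ge>0. lip n L r" if "n < d" for n
    using Cinf_on_locally_lipschitz[OF assms(1,2) Cinf_onD(3)[OF assms(3) that]]
    unfolding lip_def by blast
  then have "\<exists>r>0. \<forall>n<d. \<exists>L\<ge>0. lip n L r"
    by (intro ex_common_radius) (auto intro: lip_mono)
  then obtain r1 L where r1: "r1 > 0" "\<And>n. n < d \<Longrightarrow> L n \<ge> 0" "\<And>n. n < d \<Longrightarrow> lip n (L n) r1"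
    by metis
  obtain r2 where r2: "r2 > 0" "box_around d p r2 \<subseteq> U"
    using openin_Euclidean_space_imp_box[OF assms(1,2)] by blast
  define r where "r = min r1 r2"
  have r: "r > 0" "box_around d p r \<subseteq> U"
    using r1 r2 box_around_mono[of r r2 d p] by (auto simp: r_def)
  define K where "K = (\<Sum>n<d. L n)"
  have K: "L n \<le> K" if "n < d" for n
    unfolding K_def by (rule member_le_sum) (use that r1 in auto)
  have K0: "K \<ge> 0" using r1(2) by (auto simp: K_def intro: sum_nonneg)
  have "\<bar>g u - g v - (\<Sum>n<d. partial_deriv n g v * (u n - v n))\<bar> \<le> K * (\<Sum>n<d. \<bar>u n - v n\<bar>)\<^sup>2"
    if uv: "u \<in> box_around d p r" "v \<in> box_around d p r" for u v
  proof -
    define D where "D = (\<Sum>n<d. \<bar>u n - v n\<bar>)"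
    have D0: "D \<ge> 0" by (auto simp: D_def intro: sum_nonneg)
    have "\<bar>g u - g v - (\<Sum>n<d. partial_deriv n g v * (u n - v n))\<bar> \<le> (K * D) * (\<Sum>n<d. \<bar>u n - v n\<bar>)"
    proof (rule partial_deriv_increment_bound)
      fix w n assume w': "w \<in> topspace (Euclidean_space d)"
        "\<forall>m<d. w m \<in> closed_segment (u m) (v m)" and n: "n < d"
      then have w: "w \<in> box_around d p r" by (intro segment_in_box_around[OF uv])
      show "(\<lambda>t. g (w(n := t))) field_differentiable (at (w n))"
        using Cinf_onD(2)[OF assms(3) n] w r(2) by blast
      have "\<bar>partial_deriv n g w - partial_deriv n g v\<bar> \<le> L n * (\<Sum>m<d. \<bar>w m - v m\<bar>)"
        using r1(3)[OF n] w uv box_around_mono[of r r1 d p] by (auto simp: r_def lip_def)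
      also have "\<dots> \<le> K * D"
        unfolding D_def using w'(2) K[OF n] K0
        by (intro mult_mono sum_mono sum_nonneg)
          (auto simp: closed_segment_eq_real_ivl split: if_splits)
      finally show "\<bar>partial_deriv n g w - partial_deriv n g v\<bar> \<le> K * D" .
    qed (use uv in \<open>auto simp: box_around_def\<close>)
    then show ?thesis by (simp add: D_def power2_eq_square mult_ac)
  qed
  then show ?thesis using r K0 by blast
qed

text \<open>Once the linear part is removed, the second order estimate shows that the remainder has
  derivative 0.\<close>

lemma Cinf_on_chain_rule:
  fixes w :: "real \<Rightarrow> nat \<Rightarrow> real"
  assumes U: "openin (Euclidean_space d) U" and g: "Cinf_on d U g"
    and w: "eventually (\<lambda>t. w t \<in> U) (nhds x)"
    and deriv: "\<And>m. m < d \<Longrightarrow> ((\<lambda>t. w t m) has_real_derivative w' m) (at x)"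
  shows "((\<lambda>t. g (w t)) has_real_derivative (\<Sum>n<d. partial_deriv n g (w x) * w' n)) (at x)"
proof -
  have wx: "w x \<in> U" using eventually_nhds_x_imp_x[OF w] .
  obtain r L where r: "r > 0"
    and L: "\<And>u v. u \<in> box_around d (w x) r \<Longrightarrow> v \<in> box_around d (w x) r \<Longrightarrow>
      \<bar>g u - g v - (\<Sum>n<d. partial_deriv n g v * (u n - v n))\<bar> \<le> L * (\<Sum>n<d. \<bar>u n - v n\<bar>)\<^sup>2"
    using Cinf_on_local_second_order[OF U wx g] by blast
  have cont: "((\<lambda>t. w t m) \<longlongrightarrow> w x m) (at x)" if "m < d" for m
    using DERIV_isCont[OF deriv[OF that]] by (simp add: isCont_def)
  have U_top: "U \<subseteq> topspace (Euclidean_space d)" using U openin_subset by blast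
  have "eventually (\<lambda>t. \<forall>m\<in>{..<d}. \<bar>w t m - w x m\<bar> < r) (at x)"
    using tendstoD[OF cont r] by (intro eventually_ball_finite) (auto simp: dist_real_def)
  moreover have "eventually (\<lambda>t. w t \<in> U) (at x)"
    using w by (simp add: eventually_at_filter eventually_mono)
  ultimately have box: "eventually (\<lambda>t. w t \<in> box_around d (w x) r) (at x)"
    by eventually_elim (use U_top in \<open>auto simp: box_around_def\<close>)
  have box0: "w x \<in> box_around d (w x) r" using wx r U_top by (auto simp: box_around_def)
  define R where "R t = g (w t) - (\<Sum>n<d. partial_deriv n g (w x) * w t n)" for t
  \<comment> \<open>The quadratic bound with one of its two factors divided by \<open>t - x\<close>:
    the first sum tends to 0 while the second converges.\<close>
  define B where "B t = L * (\<Sum>n<d. \<bar>w t n - w x n\<bar>) * (\<Sum>n<d. \<bar>(w t n - w x n) / (t - x)\<bar>)" for t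
  have "(R has_real_derivative 0) (at x)"
    unfolding has_field_derivative_iff
  proof (rule tendsto_0_le[where K = 1])
    have "(B \<longlongrightarrow> L * (\<Sum>n<d. \<bar>w x n - w x n\<bar>) * (\<Sum>n<d. \<bar>w' n\<bar>)) (at x)"
      unfolding B_def using deriv
      by (intro tendsto_intros tendsto_sum tendsto_rabs cont) (auto simp: has_field_derivative_iff)
    then show "(B \<longlongrightarrow> 0) (at x)" by simp
    show "eventually (\<lambda>t. norm ((R t - R x) / (t - x)) \<le> norm (B t) * 1) (at x)"
      using box
    proof eventually_elim
      case (elim t)
      have "\<bar>R t - R x\<bar> \<le> L * (\<Sum>n<d. \<bar>w t n - w x n\<bar>)\<^sup>2"
        using L[OF elim box0] by (simp add: R_def right_diff_distrib sum_subtractf algebra_simps)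
      then have "\<bar>R t - R x\<bar> / \<bar>t - x\<bar> \<le> L * (\<Sum>n<d. \<bar>w t n - w x n\<bar>)\<^sup>2 / \<bar>t - x\<bar>"
        by (intro divide_right_mono) auto
      also have "\<dots> = B t"
        by (simp add: B_def power2_eq_square sum_divide_distrib[symmetric])
      finally show ?case by (simp add: abs_divide)
    qed
  qed
  moreover have "((\<lambda>t. \<Sum>n<d. partial_deriv n g (w x) * w t n) has_real_derivative
      (\<Sum>n<d. partial_deriv n g (w x) * w' n)) (at x)"
    by (intro DERIV_sum DERIV_cmult deriv) auto
  ultimately have "((\<lambda>t. R t + (\<Sum>n<d. partial_deriv n g (w x) * w t n)) has_real_derivative
      0 + (\<Sum>n<d. partial_deriv n g (w x) * w' n)) (at x)"
    by (rule DERIV_add)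
  then show ?thesis by (simp add: R_def)
qed

lemma sum_bigo_square:
  fixes E :: "nat \<Rightarrow> real \<Rightarrow> real"
  assumes "\<And>n. n < d \<Longrightarrow> E n \<in> O[nhds 0](\<lambda>h. h ^ k)"
  shows "(\<lambda>h. (\<Sum>n<d. \<bar>E n h\<bar>)\<^sup>2) \<in> O[nhds 0](\<lambda>h. h ^ (2 * k))"
proof -
  have "(\<lambda>h. \<Sum>n<d. \<bar>E n h\<bar>) \<in> O[nhds 0](\<lambda>h. h ^ k)"
    using assms by (intro big_sum_in_bigo) auto
  from landau_o.big.mult[OF this this] show ?thesis
    by (simp add: power2_eq_square mult_2 power_add)
qed

section \<open>Expansions along a solution\<close>

text \<open>One setting for both notions of order: a scalar problem enters with
  \<open>d = 2\<close>, time being the second component.\<close>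

locale autonomous_solution =
  fixes d :: nat and U :: "(nat \<Rightarrow> real) set" and f :: "(nat \<Rightarrow> real) \<Rightarrow> nat \<Rightarrow> real"
    and y :: "real \<Rightarrow> nat \<Rightarrow> real" and x0 \<epsilon> :: real
  assumes dim_pos: "0 < d"
    and open_domain: "openin (Euclidean_space d) U"
    and range: "f \<in> U \<rightarrow> topspace (Euclidean_space d)"
    and smooth: "\<And>m. m < d \<Longrightarrow> Cinf_on d U (\<lambda>v. f v m)"
    and eps_pos: "\<epsilon> > 0"
    and in_domain: "\<And>x. x \<in> ball x0 \<epsilon> \<Longrightarrow> y x \<in> U"
    and solution: "\<And>x m. x \<in> ball x0 \<epsilon> \<Longrightarrow> m < d \<Longrightarrow>
      ((\<lambda>t. y t m) has_real_derivative f (y x) m) (at x)"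
begin

lemma initial_in_domain: "y x0 \<in> U"
  using in_domain eps_pos by simp

lemma domain_subset: "U \<subseteq> topspace (Euclidean_space d)"
  using open_domain openin_subset by blast

lemma domain_ge: "v \<in> U \<Longrightarrow> d \<le> m \<Longrightarrow> v m = 0" "v \<in> U \<Longrightarrow> d \<le> m \<Longrightarrow> f v m = 0"
  using domain_subset range by (auto simp: topspace_Euclidean_space)

lemma eventually_near: "eventually (\<lambda>t. x0 + t \<in> ball x0 \<epsilon>) (nhds 0)"
  using eventually_nhds_in_open[of "ball 0 \<epsilon>" "0::real"] eps_pos
  by (simp add: dist_real_def)

lemma derivative_along_solution:
  assumes "Cinf_on d U g" "x \<in> ball x0 \<epsilon>"
  shows "((\<lambda>t. g (y t)) has_real_derivative (\<Sum>n<d. partial_deriv n g (y x) * f (y x) n)) (at x)"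
proof (rule Cinf_on_chain_rule[OF open_domain assms(1)])
  have "eventually (\<lambda>t. t \<in> ball x0 \<epsilon>) (nhds x)"
    using assms(2) by (intro eventually_nhds_in_open) auto
  then show "eventually (\<lambda>t. y t \<in> U) (nhds x)" by eventually_elim (rule in_domain)
qed (use assms(2) solution in auto)

text \<open>The derivative of \<open>g\<close> along the solution is a sum of products of smooth
  functions along the solution; these are expanded to order \<open>n\<close> and integrated. The
  induction closes because it ranges over all smooth \<open>g\<close>.\<close>

lemma ex_taylor_along_solution:
  assumes "Cinf_on d U g"
  shows "\<exists>p. taylor_upto n (\<lambda>t. g (y (x0 + t))) p"
  using assms
proof (induction n arbitrary: g)
  case 0
  note base = this
  have "isCont (\<lambda>t. g (y t)) x0"
    using DERIV_isCont[OF derivative_along_solution[OF base, of x0]] eps_pos by simp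
  then have "isCont (\<lambda>t. g (y (x0 + t))) 0"
    using isCont_o2[of 0 "\<lambda>t. x0 + t" "\<lambda>t. g (y t)"] by simp
  then have "(\<lambda>t. g (y (x0 + t))) \<in> O[nhds 0](\<lambda>_. 1)"
    using isCont_tendsto_nhds[of 0 "\<lambda>t. g (y (x0 + t))"]
    by (intro bigoI_tendsto[where c = "g (y x0)"]) simp_all
  then show ?case by (intro exI[of _ 0]) (simp add: taylor_upto_0_iff)
next
  case (Suc n)
  have "\<exists>p. taylor_upto n (\<lambda>t. partial_deriv m g (y (x0 + t))) p" if "m < d" for m
    using Suc.IH Cinf_onD(3)[OF Suc.prems that] by blast
  moreover have "\<exists>p. taylor_upto n (\<lambda>t. f (y (x0 + t)) m) p" if "m < d" for m
    using Suc.IH[OF smooth[OF that]] .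
  ultimately obtain p q where
    "\<And>m. m < d \<Longrightarrow> taylor_upto n (\<lambda>t. partial_deriv m g (y (x0 + t))) (p m)"
    "\<And>m. m < d \<Longrightarrow> taylor_upto n (\<lambda>t. f (y (x0 + t)) m) (q m)"
    by metis
  then have *: "taylor_upto n (\<lambda>t. \<Sum>m<d. partial_deriv m g (y (x0 + t)) * f (y (x0 + t)) m)
      (\<Sum>m<d. p m * q m)"
    by (intro taylor_upto_sum taylor_upto_mult) auto
  obtain P where P: "pderiv P = (\<Sum>m<d. p m * q m)" "poly P 0 = g (y (x0 + 0))"
    by (rule ex_poly_antiderivative)
  have "eventually (\<lambda>t. ((\<lambda>t. g (y (x0 + t))) has_real_derivative
      (\<Sum>m<d. partial_deriv m g (y (x0 + t)) * f (y (x0 + t)) m)) (at t)) (nhds 0)"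
    using eventually_near
  proof eventually_elim
    case (elim t)
    show ?case
      using derivative_along_solution[OF Suc.prems elim] by (simp add: DERIV_shift add.commute)
  qed
  from taylor_upto_integral[OF this, of n P] P * show ?case by auto
qed

lemma ex_taylor_solution:
  assumes "m < d"
  shows "\<exists>P. taylor_upto 6 (\<lambda>t. y (x0 + t) m) P \<and>
    taylor_upto 5 (\<lambda>t. f (y (x0 + t)) m) (pderiv P) \<and> poly P 0 = y x0 m"
proof -
  obtain p where p: "taylor_upto 5 (\<lambda>t. f (y (x0 + t)) m) p"
    using ex_taylor_along_solution[OF smooth[OF assms]] by blast
  obtain P where P: "pderiv P = p" "poly P 0 = y (x0 + 0) m"
    by (rule ex_poly_antiderivative)
  have "eventually (\<lambda>t. ((\<lambda>t. y (x0 + t) m) has_real_derivative f (y (x0 + t)) m) (at t)) (nhds 0)"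
    using eventually_near
  proof eventually_elim
    case (elim t)
    show ?case using solution[OF elim assms] by (simp add: DERIV_shift add.commute)
  qed
  from taylor_upto_integral[OF this, of 5 P] P p show ?thesis by auto
qed

text \<open>The \<open>q\<close>'s are the coefficients of y' = f(y), whose integration divides them
  by 1, ..., 5. Sharing them makes the quadrature defects explicit multiples of them.\<close>

lemma ex_taylor_solution_coeffs:
  "\<exists>q0 q1 q2 q3 q4. \<forall>m<d.
     taylor_upto 6 (\<lambda>t. y (x0 + t) m) [:y x0 m, q0 m, q1 m / 2, q2 m / 3, q3 m / 4, q4 m / 5:] \<and>
     taylor_upto 5 (\<lambda>t. f (y (x0 + t)) m) [:q0 m, q1 m, q2 m, q3 m, q4 m:]"
proof -
  obtain P where P: "\<And>m. m < d \<Longrightarrow> taylor_upto 6 (\<lambda>t. y (x0 + t) m) (P m)"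
    "\<And>m. m < d \<Longrightarrow> taylor_upto 5 (\<lambda>t. f (y (x0 + t)) m) (pderiv (P m))"
    "\<And>m. m < d \<Longrightarrow> poly (P m) 0 = y x0 m"
    using ex_taylor_solution by metis
  define q where "q k m = of_nat (Suc k) * coeff (P m) (Suc k)" for k m
  have "taylor_upto 6 (\<lambda>t. y (x0 + t) m) [:y x0 m, q 0 m, q 1 m / 2, q 2 m / 3, q 3 m / 4, q 4 m / 5:]"
    if "m < d" for m
    by (rule taylor_upto_cong[OF P(1)[OF that]])
      (use P(3)[OF that] in \<open>auto simp: less_Suc_eq q_def poly_0_coeff_0 coeff_pCons eval_nat_numeral\<close>)
  moreover have "taylor_upto 5 (\<lambda>t. f (y (x0 + t)) m) [:q 0 m, q 1 m, q 2 m, q 3 m, q 4 m:]"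
    if "m < d" for m
    by (rule taylor_upto_cong[OF P(2)[OF that]])
      (auto simp: less_Suc_eq q_def coeff_pderiv coeff_pCons eval_nat_numeral)
  ultimately show ?thesis by blast
qed

text \<open>Near h = 0 both points lie in a box where the second order estimate holds, and squaring
  the stage error doubles the exponent. The second claim is what later keeps the next stage in
  R^d.\<close>

lemma stage_difference_bigo:
  fixes z Y :: "real \<Rightarrow> nat \<Rightarrow> real"
  assumes z: "\<And>h. z h = y (x0 + c * h)"
    and E: "\<And>n. n < d \<Longrightarrow> (\<lambda>h. z h n - Y h n) \<in> O[nhds 0](\<lambda>h. h ^ Suc k)"
    and Y: "eventually (\<lambda>h. Y h \<in> topspace (Euclidean_space d)) (nhds 0)"
    and m: "m < d"
  shows "(\<lambda>h. f (z h) m - f (Y h) m - (\<Sum>n<d. partial_deriv n (\<lambda>v. f v m) (z h) * (z h n - Y h n)))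
           \<in> O[nhds 0](\<lambda>h. h ^ (2 * Suc k))" (is ?bigo)
    and "eventually (\<lambda>h. Y h \<in> U) (nhds 0)"
proof -
  obtain r L where r: "r > 0" "box_around d (y x0) r \<subseteq> U"
    and L: "\<And>u v. u \<in> box_around d (y x0) r \<Longrightarrow> v \<in> box_around d (y x0) r \<Longrightarrow>
      \<bar>f u m - f v m - (\<Sum>n<d. partial_deriv n (\<lambda>v. f v m) v * (u n - v n))\<bar>
        \<le> L * (\<Sum>n<d. \<bar>u n - v n\<bar>)\<^sup>2"
    using Cinf_on_local_second_order[OF open_domain initial_in_domain smooth[OF m]] by blast
  have lim_arg: "((\<lambda>h. x0 + c * h) \<longlongrightarrow> x0) (nhds (0::real))"
    using isCont_tendsto_nhds[of 0 "\<lambda>h. x0 + c * h"] by simp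
  have z_lim: "((\<lambda>h. z h n) \<longlongrightarrow> y x0 n) (nhds 0)" if n: "n < d" for n
  proof -
    have "isCont (\<lambda>t. y t n) x0"
      using DERIV_isCont[OF solution[of x0, OF _ n]] eps_pos by simp
    then have "((\<lambda>t. y t n) \<longlongrightarrow> y x0 n) (nhds x0)"
      by (rule isCont_tendsto_nhds)
    from filterlim_compose[OF this lim_arg] show ?thesis by (simp add: z)
  qed
  have Y_lim: "((\<lambda>h. Y h n) \<longlongrightarrow> y x0 n) (nhds 0)" if n: "n < d" for n
  proof -
    \<comment> \<open>The exponent is positive, which forces the stage to converge to the initial
      value.\<close>
    have "((\<lambda>h::real. h ^ Suc k) \<longlongrightarrow> 0) (nhds 0)"
      using isCont_tendsto_nhds[of 0 "\<lambda>h::real. h ^ Suc k"] by simp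
    with E[OF n] have "((\<lambda>h. z h n - Y h n) \<longlongrightarrow> 0) (nhds 0)"
      by (auto elim!: landau_o.bigE intro: tendsto_0_le simp: mult.commute)
    from tendsto_diff[OF z_lim[OF n] this] show ?thesis by simp
  qed
  have box: "eventually (\<lambda>h. w h \<in> box_around d (y x0) r) (nhds 0)"
    if top: "eventually (\<lambda>h. w h \<in> topspace (Euclidean_space d)) (nhds 0)"
      and lim: "\<And>n. n < d \<Longrightarrow> ((\<lambda>h. w h n) \<longlongrightarrow> y x0 n) (nhds 0)" for w :: "real \<Rightarrow> nat \<Rightarrow> real"
  proof -
    have "eventually (\<lambda>h. \<forall>n\<in>{..<d}. \<bar>w h n - y x0 n\<bar> < r) (nhds 0)"
      using tendstoD[OF lim r(1)] by (intro eventually_ball_finite) (auto simp: dist_real_def)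
    with top show ?thesis by eventually_elim (auto simp: box_around_def)
  qed
  have "eventually (\<lambda>h. x0 + c * h \<in> ball x0 \<epsilon>) (nhds 0)"
    using lim_arg eps_pos by (intro topological_tendstoD) auto
  then have "eventually (\<lambda>h. z h \<in> topspace (Euclidean_space d)) (nhds 0)"
    by eventually_elim (use in_domain domain_subset z in auto)
  then have z_box: "eventually (\<lambda>h. z h \<in> box_around d (y x0) r) (nhds 0)"
    by (rule box) (rule z_lim)
  have Y_box: "eventually (\<lambda>h. Y h \<in> box_around d (y x0) r) (nhds 0)"
    using Y by (rule box) (rule Y_lim)
  then show "eventually (\<lambda>h. Y h \<in> U) (nhds 0)"
    by eventually_elim (use r in auto)
  have "(\<lambda>h. f (z h) m - f (Y h) m - (\<Sum>n<d. partial_deriv n (\<lambda>v. f v m) (z h) * (z h n - Y h n)))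
      \<in> O[nhds 0](\<lambda>h. (\<Sum>n<d. \<bar>z h n - Y h n\<bar>)\<^sup>2)"
  proof (rule bigoI)
    show "eventually (\<lambda>h. norm (f (z h) m - f (Y h) m -
        (\<Sum>n<d. partial_deriv n (\<lambda>v. f v m) (z h) * (z h n - Y h n)))
        \<le> L * norm ((\<Sum>n<d. \<bar>z h n - Y h n\<bar>)\<^sup>2)) (nhds 0)"
      using z_box Y_box
    proof eventually_elim
      case (elim h)
      \<comment> \<open>The estimate is applied to the increment from \<open>z\<close> to
        \<open>Y\<close>, so that the Jacobian is taken on the solution; this reverses all
        signs.\<close>
      have "(\<Sum>n<d. partial_deriv n (\<lambda>v. f v m) (z h) * (Y h n - z h n))
          = - (\<Sum>n<d. partial_deriv n (\<lambda>v. f v m) (z h) * (z h n - Y h n))"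
        by (simp add: sum_negf[symmetric] algebra_simps)
      then have eq: "\<bar>f (Y h) m - f (z h) m - (\<Sum>n<d. partial_deriv n (\<lambda>v. f v m) (z h) * (Y h n - z h n))\<bar>
          = \<bar>f (z h) m - f (Y h) m - (\<Sum>n<d. partial_deriv n (\<lambda>v. f v m) (z h) * (z h n - Y h n))\<bar>"
        by linarith
      show ?case
        using L[OF elim(2,1)] by (simp only: eq abs_minus_commute real_norm_def abs_power2)
    qed
  qed
  also have "(\<lambda>h. (\<Sum>n<d. \<bar>z h n - Y h n\<bar>)\<^sup>2) \<in> O[nhds 0](\<lambda>h. h ^ (2 * Suc k))"
    by (rule sum_bigo_square) (rule E)
  finally show ?bigo .
qed

end

section \<open>Stage errors\<close>

lemma coeff_pcompose_scale: "coeff (p \<circ>\<^sub>p [:0, c:]) k = c ^ k * coeff p k" for c :: real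
proof (induction p arbitrary: k)
  case (pCons a p)
  then show ?case
    by (cases k) (simp_all add: pcompose_pCons coeff_pCons mult_ac)
qed simp

lemma taylor_upto_scaled_sum:
  assumes "taylor_upto N u p"
  shows "taylor_upto (Suc N) (\<lambda>h. h * (\<Sum>j<n. a j * u (c j * h)))
           (pCons 0 (\<Sum>j<n. smult (a j) (p \<circ>\<^sub>p [:0, c j:])))"
  by (intro taylor_upto_shift taylor_upto_sum taylor_upto_cmult taylor_upto_scale_arg assms)

context autonomous_solution
begin

text \<open>Near \<open>h = 0\<close> this is the error of the rule with weights \<open>a\<close>
  and nodes \<open>c\<close> for the integral of y' over a step \<open>\<gamma> * h\<close>. Row i
  of \<open>A\<close> with \<open>\<gamma>\<close> = c_i gives a stage, \<open>b\<close> with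
  \<open>\<gamma>\<close> = 1 the final step.\<close>

definition quadrature_defect :: "real \<Rightarrow> (nat \<Rightarrow> real) \<Rightarrow> (nat \<Rightarrow> real) \<Rightarrow> nat \<Rightarrow> nat \<Rightarrow> real \<Rightarrow> real" where
  "quadrature_defect \<gamma> a c n m h =
     y (x0 + \<gamma> * h) m - y x0 m - h * (\<Sum>j<n. a j * f (y (x0 + c j * h)) m)"

definition stage_error :: "real list list \<Rightarrow> (nat \<Rightarrow> real) \<Rightarrow> nat \<Rightarrow> nat \<Rightarrow> real \<Rightarrow> real" where
  "stage_error A c i m h = y (x0 + c i * h) m - rk_stage_vec A f (y x0) h i m"

definition slope_error :: "real list list \<Rightarrow> (nat \<Rightarrow> real) \<Rightarrow> nat \<Rightarrow> nat \<Rightarrow> real \<Rightarrow> real" where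
  "slope_error A c i m h = f (y (x0 + c i * h)) m - f (rk_stage_vec A f (y x0) h i) m"

definition jacobian :: "nat \<Rightarrow> nat \<Rightarrow> real \<Rightarrow> real" where
  "jacobian m n t = partial_deriv n (\<lambda>v. f v m) (y (x0 + t))"

lemma ex_taylor_jacobian:
  "\<exists>P. \<forall>m<d. \<forall>n<d. taylor_upto N (jacobian m n) (P m n)"
proof -
  have "\<exists>p. taylor_upto N (jacobian m n) p" if "m < d" "n < d" for m n
    unfolding jacobian_def using ex_taylor_along_solution Cinf_onD(3) smooth that by blast
  then show ?thesis by metis
qed

text \<open>The factor accompanying each \<open>q\<close> is the error of the rule on a monomial,
  since y' is expanded into monomials.\<close>

lemma taylor_quadrature_defect:
  assumes "taylor_upto 6 (\<lambda>t. y (x0 + t) m) [:y x0 m, q0, q1 / 2, q2 / 3, q3 / 4, q4 / 5:]"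
    and "taylor_upto 5 (\<lambda>t. f (y (x0 + t)) m) [:q0, q1, q2, q3, q4:]"
  shows "taylor_upto 6 (quadrature_defect \<gamma> a c n m)
    [:0, q0 * (\<gamma> - (\<Sum>j<n. a j)), q1 * (\<gamma>^2 / 2 - (\<Sum>j<n. a j * c j)),
      q2 * (\<gamma>^3 / 3 - (\<Sum>j<n. a j * c j ^ 2)), q3 * (\<gamma>^4 / 4 - (\<Sum>j<n. a j * c j ^ 3)),
      q4 * (\<gamma>^5 / 5 - (\<Sum>j<n. a j * c j ^ 4)):]"
proof -
  have "taylor_upto 6 (\<lambda>h. h * (\<Sum>j<n. a j * f (y (x0 + c j * h)) m))
     (pCons 0 (\<Sum>j<n. smult (a j) ([:q0, q1, q2, q3, q4:] \<circ>\<^sub>p [:0, c j:])))"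
    using taylor_upto_scaled_sum[OF assms(2)] by simp
  then have "taylor_upto 6 (quadrature_defect \<gamma> a c n m)
      ([:y x0 m, q0, q1 / 2, q2 / 3, q3 / 4, q4 / 5:] \<circ>\<^sub>p [:0, \<gamma>:] - [:y x0 m:] -
       pCons 0 (\<Sum>j<n. smult (a j) ([:q0, q1, q2, q3, q4:] \<circ>\<^sub>p [:0, c j:])))"
    unfolding quadrature_defect_def
    by (intro taylor_upto_diff taylor_upto_const taylor_upto_scale_arg[OF assms(1)])
  then show ?thesis
    by (rule taylor_upto_cong)
      (auto simp: less_Suc_eq eval_nat_numeral coeff_pcompose_scale coeff_sum right_diff_distrib
        sum_distrib_left mult_ac)
qed

section \<open>The error recursion and its Taylor expansions\<close>

lemma stage_error_eq:
  "stage_error A c i m h = quadrature_defect (c i) (\<lambda>j. A ! i ! j) c i m h +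
     h * (\<Sum>j<i. A ! i ! j * slope_error A c j m h)"
  by (subst stage_error_def, subst rk_stage_vec.simps)
    (simp add: quadrature_defect_def slope_error_def right_diff_distrib sum_subtractf)

lemma step_error_eq:
  "y (x0 + h) m - rk_step_vec A b f (y x0) h m =
     quadrature_defect 1 (\<lambda>j. b ! j) c (length b) m h +
     h * (\<Sum>j<length b. b ! j * slope_error A c j m h)"
  by (simp add: rk_step_vec_def quadrature_defect_def slope_error_def right_diff_distrib sum_subtractf)

text \<open>Serves the stages and the final step alike. The weight \<open>a j\<close> stays inside
  the last hypothesis, so that a stage of weight zero needs no expansion of its slope error.\<close>

lemma taylor_error:
  assumes "\<And>h. e h = quadrature_defect \<gamma> a c n m h + h * (\<Sum>j<n. a j * slope_error A c j m h)"
    and "taylor_upto (Suc N) (quadrature_defect \<gamma> a c n m) D"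
    and "\<And>j. j < n \<Longrightarrow> taylor_upto N (\<lambda>h. a j * slope_error A c j m h) (\<sigma> j)"
  shows "taylor_upto (Suc N) e (D + pCons 0 (\<Sum>j<n. \<sigma> j))"
proof -
  have e: "e = (\<lambda>h. quadrature_defect \<gamma> a c n m h + h * (\<Sum>j<n. a j * slope_error A c j m h))"
    using assms(1) by blast
  have "taylor_upto N (\<lambda>h. \<Sum>j<n. a j * slope_error A c j m h) (\<Sum>j<n. \<sigma> j)"
    using assms(3) by (intro taylor_upto_sum) simp
  from taylor_upto_add[OF assms(2) taylor_upto_shift[OF this]] show ?thesis unfolding e .
qed

text \<open>Linearisation leaves a remainder of order \<open>2 * Suc k\<close>, which is negligible
  up to order \<open>N\<close>; what remains is the Jacobian at c_j h times the stage error.\<close>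

lemma taylor_slope_error:
  assumes E: "\<And>n. n < d \<Longrightarrow> taylor_upto N (stage_error A c j n) (p n)"
    and E0: "\<And>n. n < d \<Longrightarrow> stage_error A c j n \<in> O[nhds 0](\<lambda>h. h ^ Suc k)"
    and top: "eventually (\<lambda>h. rk_stage_vec A f (y x0) h j \<in> topspace (Euclidean_space d)) (nhds 0)"
    and J: "\<And>n. n < d \<Longrightarrow> taylor_upto N (jacobian m n) (P n)"
    and N: "N \<le> 2 * Suc k" and m: "m < d"
  shows "taylor_upto N (slope_error A c j m) (\<Sum>n<d. (P n \<circ>\<^sub>p [:0, c j:]) * p n)"
proof -
  have "(\<lambda>h. slope_error A c j m h - (\<Sum>n<d. jacobian m n (c j * h) * stage_error A c j n h))
      \<in> O[nhds 0](\<lambda>h. h ^ (2 * Suc k))"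
    unfolding slope_error_def stage_error_def jacobian_def
    by (rule stage_difference_bigo(1)[where c = "c j"])
      (use E0 top m in \<open>auto simp: stage_error_def[abs_def]\<close>)
  then have "taylor_upto N (\<lambda>h. slope_error A c j m h -
      (\<Sum>n<d. jacobian m n (c j * h) * stage_error A c j n h)) 0"
    unfolding taylor_upto_0_iff using N by (rule bigo_power_nhds_0_mono)
  moreover have "taylor_upto N (\<lambda>h. \<Sum>n<d. jacobian m n (c j * h) * stage_error A c j n h)
      (\<Sum>n<d. (P n \<circ>\<^sub>p [:0, c j:]) * p n)"
    using J E by (intro taylor_upto_sum taylor_upto_mult taylor_upto_scale_arg) auto
  ultimately show ?thesis using taylor_upto_add by fastforce
qed

lemma slope_error_bigo:
  assumes E: "\<And>n. n < d \<Longrightarrow> stage_error A c j n \<in> O[nhds 0](\<lambda>h. h ^ Suc k)"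
    and top: "eventually (\<lambda>h. rk_stage_vec A f (y x0) h j \<in> topspace (Euclidean_space d)) (nhds 0)"
    and m: "m < d"
  shows "slope_error A c j m \<in> O[nhds 0](\<lambda>h. h ^ Suc k)"
proof -
  obtain P where P: "\<And>n. n < d \<Longrightarrow> taylor_upto (Suc k) (jacobian m n) (P n)"
    using ex_taylor_jacobian[of "Suc k"] m by blast
  have "taylor_upto (Suc k) (slope_error A c j m) (\<Sum>n<d. (P n \<circ>\<^sub>p [:0, c j:]) * 0)"
    using E by (intro taylor_slope_error[where k = k] top P m) (auto simp: taylor_upto_0_iff)
  then show ?thesis by (simp add: taylor_upto_0_iff)
qed

text \<open>The row sums cancel the linear term of the defect, and slope errors enter with a factor
  \<open>h\<close>. Both claims share one induction: the slope estimate needs the earlier stages in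
  R^d, and a stage lies in R^d because \<open>f\<close> maps the earlier stages, which are in
  \<open>U\<close>, into R^d.\<close>

lemma stage_error_bigo_square:
  assumes row_sum: "\<And>i. i < s \<Longrightarrow> (\<Sum>j<i. A ! i ! j) = c i"
    and "i < s"
  shows "m < d \<Longrightarrow> stage_error A c i m \<in> O[nhds 0](\<lambda>h. h ^ 2)"
    and "eventually (\<lambda>h. rk_stage_vec A f (y x0) h i \<in> topspace (Euclidean_space d)) (nhds 0)"
proof -
  obtain q0 q1 q2 q3 q4 where q: "\<And>m. m < d \<Longrightarrow>
     taylor_upto 6 (\<lambda>t. y (x0 + t) m) [:y x0 m, q0 m, q1 m / 2, q2 m / 3, q3 m / 4, q4 m / 5:]"
     "\<And>m. m < d \<Longrightarrow> taylor_upto 5 (\<lambda>t. f (y (x0 + t)) m) [:q0 m, q1 m, q2 m, q3 m, q4 m:]"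
    using ex_taylor_solution_coeffs by blast
  have "(\<forall>m<d. stage_error A c i m \<in> O[nhds 0](\<lambda>h. h ^ 2)) \<and>
    eventually (\<lambda>h. rk_stage_vec A f (y x0) h i \<in> topspace (Euclidean_space d)) (nhds 0)"
    using \<open>i < s\<close>
  proof (induction i rule: less_induct)
    case (less i)
    have IH: "\<And>j m. j < i \<Longrightarrow> m < d \<Longrightarrow> stage_error A c j m \<in> O[nhds 0](\<lambda>h. h ^ Suc 1)"
      "\<And>j. j < i \<Longrightarrow> eventually (\<lambda>h. rk_stage_vec A f (y x0) h j \<in> topspace (Euclidean_space d)) (nhds 0)"
      using less.IH less.prems by (auto simp: numeral_2_eq_2)
    have "stage_error A c i m \<in> O[nhds 0](\<lambda>h. h ^ 2)" if m: "m < d" for m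
    proof -
      have "taylor_upto (Suc 1) (quadrature_defect (c i) (\<lambda>j. A ! i ! j) c i m) 0"
        using taylor_upto_mono[OF taylor_quadrature_defect[OF q(1)[OF m] q(2)[OF m]], of "Suc 1"]
        by (rule taylor_upto_cong)
          (use row_sum[OF less.prems] in \<open>auto simp: less_Suc_eq\<close>)
      moreover have "taylor_upto 1 (\<lambda>h. A ! i ! j * slope_error A c j m h) 0" if j: "j < i" for j
      proof -
        have "slope_error A c j m \<in> O[nhds 0](\<lambda>h. h ^ Suc 1)"
          using IH j m by (intro slope_error_bigo) auto
        then have "taylor_upto 1 (slope_error A c j m) 0"
          unfolding taylor_upto_0_iff by (rule bigo_power_nhds_0_mono) simp
        from taylor_upto_cmult[OF this] show ?thesis by simp
      qed
      ultimately have "taylor_upto (Suc 1) (stage_error A c i m) (0 + pCons 0 (\<Sum>j<i. 0))"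
        by (intro taylor_error[OF stage_error_eq])
      then show ?thesis by (simp add: taylor_upto_0_iff numeral_2_eq_2)
    qed
    moreover have "eventually (\<lambda>h. \<forall>j\<in>{..<i}. rk_stage_vec A f (y x0) h j \<in> U) (nhds 0)"
    proof (intro eventually_ball_finite ballI)
      fix j assume "j \<in> {..<i}"
      then have j: "j < i" by simp
      show "eventually (\<lambda>h. rk_stage_vec A f (y x0) h j \<in> U) (nhds 0)"
        using stage_difference_bigo(2)[where c = "c j" and k = 1, OF refl _ IH(2)[OF j] dim_pos]
          IH(1)[OF j] by (simp add: stage_error_def[abs_def])
    qed simp
    then have "eventually (\<lambda>h. rk_stage_vec A f (y x0) h i \<in> topspace (Euclidean_space d)) (nhds 0)"
    proof eventually_elim
      case (elim h)
      then show ?case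
        by (subst rk_stage_vec.simps)
          (simp add: topspace_Euclidean_space domain_ge initial_in_domain)
    qed
    ultimately show ?case by blast
  qed
  then show "m < d \<Longrightarrow> stage_error A c i m \<in> O[nhds 0](\<lambda>h. h ^ 2)"
    and "eventually (\<lambda>h. rk_stage_vec A f (y x0) h i \<in> topspace (Euclidean_space d)) (nhds 0)"
    by blast+
qed

lemma slope_error_0:
  assumes "c 0 = 0"
  shows "slope_error A c 0 m = (\<lambda>_. 0)"
proof -
  have "rk_stage_vec A f (y x0) h 0 = y x0" for h by (subst rk_stage_vec.simps) simp
  then show ?thesis using assms by (intro ext) (simp add: slope_error_def)
qed

end

section \<open>The coefficients of the method\<close>

abbreviation method_node :: "nat \<Rightarrow> real" where
  "method_node i \<equiv> method_c ! i"

lemma length_method_b: "length method_b = 6"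
  by (simp add: method_b_def)

lemma method_node_0: "method_node 0 = 0"
  by (simp add: method_c_def)

lemma method_row_sum:
  assumes "i < 6" shows "(\<Sum>j<i. method_A ! i ! j) = method_node i"
proof -
  have "i = 0 \<or> i = 1 \<or> i = 2 \<or> i = 3 \<or> i = 4 \<or> i = 5" using assms by auto
  then show ?thesis by (auto simp: method_A_def method_c_def eval_nat_numeral lessThan_Suc)
qed

section \<open>The method for vector and scalar problems\<close>

context autonomous_solution
begin

text \<open>Only the Jacobian at the initial point affects the leading term. With \<open>k\<close>
  positive the linearisation remainder O(h^(2k)) is O(h^(k+1)).\<close>

lemma slope_error_leading_term:
  assumes E: "\<And>n. n < d \<Longrightarrow> taylor_upto (Suc k) (stage_error A c j n) (monom (e n) k)"
    and top: "eventually (\<lambda>h. rk_stage_vec A f (y x0) h j \<in> topspace (Euclidean_space d)) (nhds 0)"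
    and J: "\<And>n. n < d \<Longrightarrow> taylor_upto (Suc k) (jacobian m n) (P n)"
    and k: "0 < k" and m: "m < d"
  shows "taylor_upto (Suc k) (slope_error A c j m) (monom (\<Sum>n<d. coeff (P n) 0 * e n) k)"
proof -
  obtain l where l: "k = Suc l" using k by (cases k) auto
  have "stage_error A c j n \<in> O[nhds 0](\<lambda>h. h ^ Suc l)" if "n < d" for n
    using taylor_upto_mono[OF E[OF that], of "Suc l"] by (rule taylor_upto_bigo) (auto simp: l)
  from taylor_slope_error[OF E this top J _ m]
  have "taylor_upto (Suc k) (slope_error A c j m) (\<Sum>n<d. (P n \<circ>\<^sub>p [:0, c j:]) * monom (e n) k)"
    by (simp add: l)
  then show ?thesis
    by (rule taylor_upto_cong)
      (auto simp: coeff_sum mult.commute[of _ "monom _ _"] coeff_monom_mult coeff_pcompose_scale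
        less_Suc_eq poly_0_coeff_0 mult.commute)
qed

lemma taylor_stage_error:
  assumes "taylor_upto (Suc N) (quadrature_defect (c i) (\<lambda>j. A ! i ! j) c i m) D"
    and "\<And>j. j < i \<Longrightarrow> taylor_upto N (slope_error A c j m) (S j)"
  shows "taylor_upto (Suc N) (stage_error A c i m) (D + pCons 0 (\<Sum>j<i. smult (A ! i ! j) (S j)))"
  using assms by (intro taylor_error[OF stage_error_eq] taylor_upto_cmult) auto

text \<open>The lists hold \<open>c\<^sub>i\<^sup>k / k - \<Sum>\<^sub>j a\<^sub>i\<^sub>j c\<^sub>j\<^sup>k\<^sup>-\<^sup>1\<close> for \<open>k = 2, 3, 4\<close>.\<close>

lemma taylor_method_defect:
  assumes "taylor_upto 6 (\<lambda>t. y (x0 + t) m) [:y x0 m, q0, q1 / 2, q2 / 3, q3 / 4, q4 / 5:]"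
    and "taylor_upto 5 (\<lambda>t. f (y (x0 + t)) m) [:q0, q1, q2, q3, q4:]"
  shows "i < 6 \<Longrightarrow> taylor_upto 5 (quadrature_defect (method_node i) (\<lambda>j. method_A ! i ! j) method_node i m)
      [:0, 0, q1 * [0, 1/32, -1/8, 0, 0, 0] ! i, q2 * [0, 1/192, -1/48, 0, 0, 0] ! i,
        q3 * [0, 1/1024, 0, 9/1024, 9/4000, -1/16] ! i:]"
    and "taylor_upto 6 (quadrature_defect 1 (\<lambda>j. method_b ! j) method_node 6 m) 0"
proof -
  assume "i < 6"
  then have i: "i = 0 \<or> i = 1 \<or> i = 2 \<or> i = 3 \<or> i = 4 \<or> i = 5" by auto
  show "taylor_upto 5 (quadrature_defect (method_node i) (\<lambda>j. method_A ! i ! j) method_node i m)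
      [:0, 0, q1 * [0, 1/32, -1/8, 0, 0, 0] ! i, q2 * [0, 1/192, -1/48, 0, 0, 0] ! i,
        q3 * [0, 1/1024, 0, 9/1024, 9/4000, -1/16] ! i:]"
    by (rule taylor_upto_cong[OF taylor_upto_mono[OF taylor_quadrature_defect[OF assms]]])
      (use i in \<open>auto simp: less_Suc_eq eval_nat_numeral lessThan_Suc method_A_def method_c_def\<close>)
next
  \<comment> \<open>The weights integrate 1, t, ..., t^4 exactly, so up to O(h^6) the step error
    comes from the slope errors alone.\<close>
  show "taylor_upto 6 (quadrature_defect 1 (\<lambda>j. method_b ! j) method_node 6 m) 0"
    by (rule taylor_upto_cong[OF taylor_quadrature_defect[OF assms]])
      (auto simp: less_Suc_eq eval_nat_numeral lessThan_Suc method_b_def method_c_def)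
qed

lemma method_stage_error_bigo:
  "i < 6 \<Longrightarrow> m < d \<Longrightarrow> stage_error method_A method_node i m \<in> O[nhds 0](\<lambda>h. h ^ Suc 1)"
  using stage_error_bigo_square(1)[of 6 method_A method_node i] method_row_sum
  by (simp add: numeral_2_eq_2)

lemma method_stage_in_topspace:
  "i < 6 \<Longrightarrow>
    eventually (\<lambda>h. rk_stage_vec method_A f (y x0) h i \<in> topspace (Euclidean_space d)) (nhds 0)"
  using stage_error_bigo_square(2)[of 6 method_A method_node i] method_row_sum by blast

text \<open>Only leading terms are followed. Stage errors begin with \<open>\<alpha> i\<close> y''
  h^2, which vanishes for the stages 3, 4, 5; theirs begin with \<open>\<beta> i\<close> J y'' h^3.
  The h^4 term of the step vanishes because the sum of b_i \<open>\<beta> i\<close> is 0.\<close>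

lemma method_step_error_order4:
  assumes "m < d"
  shows "(\<lambda>h. y (x0 + h) m - rk_step_vec method_A method_b f (y x0) h m) \<in> O[nhds 0](\<lambda>h. h ^ 5)"
proof -
  let ?E = "stage_error method_A method_node" and ?S = "slope_error method_A method_node"
  let ?D = "\<lambda>i. quadrature_defect (method_node i) (\<lambda>j. method_A ! i ! j) method_node i"
  obtain q0 q1 q2 q3 q4 where q: "\<And>m. m < d \<Longrightarrow>
     taylor_upto 6 (\<lambda>t. y (x0 + t) m) [:y x0 m, q0 m, q1 m / 2, q2 m / 3, q3 m / 4, q4 m / 5:]"
     "\<And>m. m < d \<Longrightarrow> taylor_upto 5 (\<lambda>t. f (y (x0 + t)) m) [:q0 m, q1 m, q2 m, q3 m, q4 m:]"
    using ex_taylor_solution_coeffs by blast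
  note defect = taylor_method_defect[OF q]
  obtain P where P: "\<And>m n. m < d \<Longrightarrow> n < d \<Longrightarrow> taylor_upto 5 (jacobian m n) (P m n)"
    using ex_taylor_jacobian by blast
  \<comment> \<open>Since \<open>q1\<close> is y'' at \<open>x0\<close>, \<open>p\<close> is J y''
    and the later \<open>r\<close> is J^2 y'' there.\<close>
  define p where "p m = (\<Sum>n<d. coeff (P m n) 0 * q1 n)" for m
  define \<alpha> :: "nat \<Rightarrow> real" where "\<alpha> i = [0, 1/32, -1/8, 0, 0, 0] ! i" for i
  have S_square: "taylor_upto 2 (?S i m) 0" if "i < 6" "m < d" for i m
    using slope_error_bigo[OF method_stage_error_bigo[OF that(1)] method_stage_in_topspace[OF that(1)] that(2)]
    by (simp add: taylor_upto_0_iff numeral_2_eq_2)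
  \<comment> \<open>Slope errors are O(h^2) and gain a factor \<open>h\<close>, so to this order
    only the defect counts.\<close>
  have E3: "taylor_upto 3 (?E i m) (monom (\<alpha> i * q1 m) 2)" if "i < 6" "m < d" for i m
  proof -
    have "taylor_upto (Suc 2) (?D i m) [:0, 0, q1 m * [0, 1/32, -1/8, 0, 0, 0] ! i,
        q2 m * [0, 1/192, -1/48, 0, 0, 0] ! i, q3 m * [0, 1/1024, 0, 9/1024, 9/4000, -1/16] ! i:]"
      using defect(1)[OF that(2,2,1)] by (rule taylor_upto_mono) simp
    from taylor_stage_error[OF this, of "\<lambda>_. 0"] S_square that
    have "taylor_upto (Suc 2) (?E i m) ([:0, 0, q1 m * [0, 1/32, -1/8, 0, 0, 0] ! i,
        q2 m * [0, 1/192, -1/48, 0, 0, 0] ! i, q3 m * [0, 1/1024, 0, 9/1024, 9/4000, -1/16] ! i:] + 0)"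
      by simp
    then have "taylor_upto (Suc 2) (?E i m) (monom (\<alpha> i * q1 m) 2)"
      by (rule taylor_upto_cong) (auto simp: less_Suc_eq eval_nat_numeral \<alpha>_def)
    then show ?thesis by simp
  qed
  have S3: "taylor_upto 3 (?S i m) (monom (\<alpha> i * p m) 2)" if "i < 6" "m < d" for i m
  proof -
    have "taylor_upto (Suc 2) (?S i m) (monom (\<Sum>n<d. coeff (P m n) 0 * (\<alpha> i * q1 n)) 2)"
      using E3[OF that(1)] taylor_upto_mono[OF P[OF that(2)]]
      by (intro slope_error_leading_term method_stage_in_topspace that) auto
    then show ?thesis by (simp add: p_def sum_distrib_left mult_ac)
  qed
  define \<beta> :: "nat \<Rightarrow> real" where "\<beta> i = (\<Sum>j<i. method_A ! i ! j * \<alpha> j)" for i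
  \<comment> \<open>For these stages the defect vanishes up to h^3; the h^3 term comes from the
    earlier slopes.\<close>
  have E4: "taylor_upto 4 (?E i m) (monom (\<beta> i * p m) 3)" if "i \<in> {3, 4, 5}" "m < d" for i m
  proof -
    have i: "i < 6" using that by auto
    have "taylor_upto (Suc 3) (?D i m) 0"
      using taylor_upto_mono[OF defect(1)[OF that(2,2) i], of "Suc 3"]
      by (rule taylor_upto_cong) (use that in \<open>auto simp: less_Suc_eq eval_nat_numeral\<close>)
    from taylor_stage_error[OF this S3] that i
    have "taylor_upto (Suc 3) (?E i m)
        (0 + pCons 0 (\<Sum>j<i. smult (method_A ! i ! j) (monom (\<alpha> j * p m) 2)))"
      by simp
    then have "taylor_upto (Suc 3) (?E i m) (monom (\<beta> i * p m) 3)"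
      by (rule taylor_upto_cong)
        (auto simp: less_Suc_eq eval_nat_numeral coeff_sum \<beta>_def sum_distrib_left mult_ac)
    then show ?thesis by simp
  qed
  define r where "r m = (\<Sum>n<d. coeff (P m n) 0 * p n)" for m
  have S4: "taylor_upto 4 (?S i m) (monom (\<beta> i * r m) 3)" if "i \<in> {3, 4, 5}" "m < d" for i m
  proof -
    have "taylor_upto (Suc 3) (?S i m) (monom (\<Sum>n<d. coeff (P m n) 0 * (\<beta> i * p n)) 3)"
      using E4[OF that(1)] taylor_upto_mono[OF P[OF that(2)]] that
      by (intro slope_error_leading_term method_stage_in_topspace) auto
    then show ?thesis by (simp add: r_def sum_distrib_left mult_ac)
  qed
  have "taylor_upto 4 (\<lambda>h. method_b ! j * ?S j m h) (smult (method_b ! j) (monom (\<beta> j * r m) 3))"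
    if "j < 6" for j
  proof (cases "j \<in> {3, 4, 5}")
    case True
    then show ?thesis by (intro taylor_upto_cmult S4 assms)
  next
    case False
    \<comment> \<open>Stage 0 is exact and has \<open>\<beta> 0 = 0\<close> as an empty sum; stages
      1 and 2 have weight zero.\<close>
    then have "j = 0 \<or> method_b ! j = 0" using that by (auto simp: method_b_def less_Suc_eq eval_nat_numeral)
    then show ?thesis
      by (auto simp: slope_error_0[of method_node, OF method_node_0] \<beta>_def taylor_upto_0_iff)
  qed
  moreover have "taylor_upto (Suc 4) (quadrature_defect 1 (\<lambda>j. method_b ! j) method_node 6 m) 0"
    using defect(2)[OF assms assms] by (rule taylor_upto_mono) simp
  ultimately have "taylor_upto (Suc 4) (\<lambda>h. y (x0 + h) m - rk_step_vec method_A method_b f (y x0) h m)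
      (0 + pCons 0 (\<Sum>j<6. smult (method_b ! j) (monom (\<beta> j * r m) 3)))"
    by (intro taylor_error[OF step_error_eq[where b = method_b, unfolded length_method_b]])
  \<comment> \<open>The h^4 coefficient is \<open>r m\<close> times -1/36 + 1/1008 + 3/112 =
    0.\<close>
  then have "taylor_upto (Suc 4) (\<lambda>h. y (x0 + h) m - rk_step_vec method_A method_b f (y x0) h m) 0"
    by (rule taylor_upto_cong)
      (auto simp: less_Suc_eq eval_nat_numeral lessThan_Suc method_b_def method_A_def \<beta>_def \<alpha>_def)
  then show ?thesis by (simp add: taylor_upto_0_iff)
qed

text \<open>Component 1 is time and is followed without error, so only the scalar function J = df/dy
  along the solution enters. Two leading coefficients of each stage error decide the h^4 and h^5
  terms of the step.\<close>

lemma method_step_error_order5: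
  assumes d: "d = 2" and f1: "\<And>v. f v 1 = 1" and y1: "\<And>t. y t 1 = t"
  shows "(\<lambda>h. y (x0 + h) 0 - rk_step_vec method_A method_b f (y x0) h 0) \<in> O[nhds 0](\<lambda>h. h ^ 6)"
proof -
  let ?c = method_node
  let ?E = "\<lambda>i. stage_error method_A ?c i 0" and ?S = "\<lambda>i. slope_error method_A ?c i 0"
  let ?D = "\<lambda>i. quadrature_defect (?c i) (\<lambda>j. method_A ! i ! j) ?c i 0"
  obtain q0 q1 q2 q3 q4 where q:
     "taylor_upto 6 (\<lambda>t. y (x0 + t) 0) [:y x0 0, q0, q1 / 2, q2 / 3, q3 / 4, q4 / 5:]"
     "taylor_upto 5 (\<lambda>t. f (y (x0 + t)) 0) [:q0, q1, q2, q3, q4:]"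
    using ex_taylor_solution_coeffs dim_pos by blast
  note defect = taylor_method_defect[OF q]
  obtain P where P: "\<And>n. n < d \<Longrightarrow> taylor_upto 5 (jacobian 0 n) (P n)"
    using ex_taylor_jacobian dim_pos by blast
  \<comment> \<open>J = \<open>J0\<close> + \<open>J1\<close> t + O(t^2); two terms match the two
    coefficients tracked per slope error.\<close>
  define J0 J1 where "J0 = coeff (P 0) 0" and "J1 = coeff (P 0) 1"
  \<comment> \<open>Row sums equal to the nodes make every stage exact for y' = 1.\<close>
  have time: "stage_error method_A ?c i 1 = (\<lambda>_. 0)" if "i < 6" for i
    using method_row_sum[OF that]
    by (rule_tac ext, subst stage_error_def, subst rk_stage_vec.simps) (simp add: f1 y1 mult.commute del: One_nat_def)
  have slope: "taylor_upto N (?S i) ((P 0 \<circ>\<^sub>p [:0, ?c i:]) * p)"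
    if i: "i < 6" and E: "taylor_upto N (?E i) p" and E0: "?E i \<in> O[nhds 0](\<lambda>h. h ^ Suc k)"
      and N: "N \<le> 2 * Suc k" "N \<le> 5" for N i p k
  proof -
    have "taylor_upto N (?S i) (\<Sum>n<d. (P n \<circ>\<^sub>p [:0, ?c i:]) * (if n = 0 then p else 0))"
    proof (rule taylor_slope_error[where k = k])
      fix n assume n: "n < d"
      then have "n = 0 \<or> n = 1" using d by auto
      then show "taylor_upto N (stage_error method_A ?c i n) (if n = 0 then p else 0)"
        "stage_error method_A ?c i n \<in> O[nhds 0](\<lambda>h. h ^ Suc k)"
        using E E0 time[OF i] by (auto simp: taylor_upto_0_iff)
      show "taylor_upto N (jacobian 0 n) (P n)"
        using P[OF n] N(2) by (rule taylor_upto_mono)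
    qed (use i N dim_pos method_stage_in_topspace in auto)
    then show ?thesis by (simp add: d lessThan_Suc eval_nat_numeral)
  qed
  \<comment> \<open>Stage errors O(h^2) leave a quadratic remainder O(h^4), so accuracy stops at
    order 4.\<close>
  have slope4: "taylor_upto 4 (?S i) [:0, 0, J0 * a, J0 * b + ?c i * J1 * a:]"
    if i: "i < 6" and E: "taylor_upto 4 (?E i) [:0, 0, a, b:]" for i a b
    by (rule taylor_upto_cong[OF slope[OF i E method_stage_error_bigo[OF i dim_pos]]])
      (auto simp: less_Suc_eq eval_nat_numeral coeff_pcompose_scale poly_0_coeff_0 J0_def J1_def)
  \<comment> \<open>Stage errors O(h^3) leave a remainder O(h^6), which permits order 5.\<close>
  have slope5: "taylor_upto 5 (?S i) [:0, 0, 0, J0 * a, J0 * b + ?c i * J1 * a:]"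
    if i: "i < 6" and E: "taylor_upto 5 (?E i) [:0, 0, 0, a, b:]" for i a b
  proof -
    have "?E i \<in> O[nhds 0](\<lambda>h. h ^ Suc 2)"
      using taylor_upto_mono[OF E, of "Suc 2"]
      by (rule taylor_upto_bigo) (auto simp: less_Suc_eq eval_nat_numeral)
    from slope[OF i E this]
    have "taylor_upto 5 (?S i) ((P 0 \<circ>\<^sub>p [:0, ?c i:]) * [:0, 0, 0, a, b:])" by simp
    then show ?thesis
      by (rule taylor_upto_cong)
        (auto simp: less_Suc_eq eval_nat_numeral coeff_pcompose_scale poly_0_coeff_0 J0_def J1_def)
  qed
  have stage: "taylor_upto 5 (?E i) ([:0, 0, q1 * [0, 1/32, -1/8, 0, 0, 0] ! i,
      q2 * [0, 1/192, -1/48, 0, 0, 0] ! i, q3 * [0, 1/1024, 0, 9/1024, 9/4000, -1/16] ! i:]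
      + pCons 0 (\<Sum>j<i. smult (method_A ! i ! j) (S j)))"
    if "i < 6" "\<And>j. j < i \<Longrightarrow> taylor_upto 4 (?S j) (S j)" for i S
  proof -
    have "taylor_upto (Suc 4) (?D i) [:0, 0, q1 * [0, 1/32, -1/8, 0, 0, 0] ! i,
        q2 * [0, 1/192, -1/48, 0, 0, 0] ! i, q3 * [0, 1/1024, 0, 9/1024, 9/4000, -1/16] ! i:]"
      using defect(1)[OF that(1)] by simp
    from taylor_stage_error[OF this that(2)] show ?thesis by simp
  qed

  have S0: "taylor_upto N (?S 0) 0" for N
    by (simp add: slope_error_0[of method_node, OF method_node_0] taylor_upto_0_iff)

  \<comment> \<open>For stages 1 and 2 the pair \<open>a\<close>, \<open>b\<close> belongs to h^2
    and h^3, for stages 3, 4, 5 to h^3 and h^4. Stages 1 and 2 reach the step only through later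
    stages, with an extra factor \<open>h\<close>, hence order 4 suffices for them.\<close>
  define a1 b1 where "a1 = q1 / 32" and "b1 = q2 / 192"
  define s1 where "s1 = [:0, 0, J0 * a1, J0 * b1 + ?c 1 * J1 * a1:]"
  have "taylor_upto 4 (?E 1) [:0, 0, a1, b1:]"
    by (rule taylor_upto_cong[OF taylor_upto_mono[OF stage[of 1 "\<lambda>_. 0"]]])
      (use S0 in \<open>auto simp: less_Suc_eq eval_nat_numeral a1_def b1_def\<close>)
  then have S1: "taylor_upto 4 (?S 1) s1"
    unfolding s1_def by (intro slope4) auto

  define a2 b2 where "a2 = - q1 / 8" and "b2 = - q2 / 48 + J0 * a1"
  define s2 where "s2 = [:0, 0, J0 * a2, J0 * b2 + ?c 2 * J1 * a2:]"
  have "taylor_upto 4 (?E 2) [:0, 0, a2, b2:]"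
    by (rule taylor_upto_cong[OF taylor_upto_mono[OF stage[of 2 "\<lambda>j. [0, s1] ! j"]]])
      (use S0 S1 in \<open>auto simp: less_Suc_eq eval_nat_numeral lessThan_Suc method_A_def
        a2_def b2_def s1_def\<close>)
  then have S2: "taylor_upto 4 (?S 2) s2"
    unfolding s2_def by (intro slope4) auto

  \<comment> \<open>From here on the defect has no h^2 or h^3 term, and the earlier slope errors
    first enter at h^3.\<close>
  define a3 b3 where "a3 = 9 / 16 * (J0 * a2)"
    and "b3 = 9 / 1024 * q3 + 9 / 16 * (J0 * b2 + ?c 2 * J1 * a2)"
  define s3 where "s3 = [:0, 0, 0, J0 * a3, J0 * b3 + ?c 3 * J1 * a3:]"
  have "taylor_upto 5 (?E 3) [:0, 0, 0, a3, b3:]"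
    by (rule taylor_upto_cong[OF stage[of 3 "\<lambda>j. [0, s1, s2] ! j"]])
      (use S0 S1 S2 in \<open>auto simp: less_Suc_eq eval_nat_numeral lessThan_Suc method_A_def
        a3_def b3_def s2_def\<close>)
  then have S3: "taylor_upto 5 (?S 3) s3"
    unfolding s3_def by (intro slope5) auto
  then have S3': "taylor_upto 4 (?S 3) s3" by (rule taylor_upto_mono) simp

  define a4 b4 where "a4 = 108 / 625 * (J0 * a1) + 63 / 2500 * (J0 * a2)"
    and "b4 = 9 / 4000 * q3 + 108 / 625 * (J0 * b1 + ?c 1 * J1 * a1)
      + 63 / 2500 * (J0 * b2 + ?c 2 * J1 * a2) - 9 / 625 * (J0 * a3)"
  define s4 where "s4 = [:0, 0, 0, J0 * a4, J0 * b4 + ?c 4 * J1 * a4:]"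
  have "taylor_upto 5 (?E 4) [:0, 0, 0, a4, b4:]"
    by (rule taylor_upto_cong[OF stage[of 4 "\<lambda>j. [0, s1, s2, s3] ! j"]])
      (use S0 S1 S2 S3' in \<open>auto simp: less_Suc_eq eval_nat_numeral lessThan_Suc method_A_def
        a4_def b4_def s1_def s2_def s3_def\<close>)
  then have S4: "taylor_upto 5 (?S 4) s4"
    unfolding s4_def by (intro slope5) auto
  then have S4': "taylor_upto 4 (?S 4) s4" by (rule taylor_upto_mono) simp

  define a5 b5 where "a5 = 152 / 15 * (J0 * a1) - 7 / 15 * (J0 * a2)"
    and "b5 = - q3 / 16 + 152 / 15 * (J0 * b1 + ?c 1 * J1 * a1)
      - 7 / 15 * (J0 * b2 + ?c 2 * J1 * a2) + 428 / 405 * (J0 * a3) - 700 / 81 * (J0 * a4)"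
  define s5 where "s5 = [:0, 0, 0, J0 * a5, J0 * b5 + ?c 5 * J1 * a5:]"
  have "taylor_upto 5 (?E 5) [:0, 0, 0, a5, b5:]"
    by (rule taylor_upto_cong[OF stage[of 5 "\<lambda>j. [0, s1, s2, s3, s4] ! j"]])
      (use S0 S1 S2 S3' S4' in \<open>auto simp: less_Suc_eq eval_nat_numeral lessThan_Suc method_A_def
        a5_def b5_def s1_def s2_def s3_def s4_def\<close>)
  then have S5: "taylor_upto 5 (?S 5) s5"
    unfolding s5_def by (intro slope5) auto

  \<comment> \<open>The zero at index 0 is the exact first stage; those at 1 and 2 are placeholders,
    as the weights vanish there.\<close>
  define s where "s = [0, 0, 0, s3, s4, s5]"
  have "taylor_upto 5 (\<lambda>h. method_b ! j * ?S j h) (smult (method_b ! j) (s ! j))" if "j < 6" for j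
  proof (cases "j = 1 \<or> j = 2")
    case True
    then show ?thesis by (auto simp: method_b_def taylor_upto_0_iff)
  next
    case False
    then have "j = 0 \<or> j = 3 \<or> j = 4 \<or> j = 5" using that by auto
    then show ?thesis
      using S0 S3 S4 S5 by (intro taylor_upto_cmult) (auto simp: s_def)
  qed
  moreover have "taylor_upto (Suc 5) (quadrature_defect 1 (\<lambda>j. method_b ! j) ?c 6 0) 0"
    using defect(2) by simp
  ultimately have "taylor_upto (Suc 5) (\<lambda>h. y (x0 + h) 0 - rk_step_vec method_A method_b f (y x0) h 0)
      (0 + pCons 0 (\<Sum>j<6. smult (method_b ! j) (s ! j)))"
    by (intro taylor_error[OF step_error_eq[where b = method_b, unfolded length_method_b]])
  then have "taylor_upto (Suc 5) (\<lambda>h. y (x0 + h) 0 - rk_step_vec method_A method_b f (y x0) h 0) 0"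
  proof (rule taylor_upto_cong)
    fix k :: nat assume "k < Suc 5"
    then have "k = 0 \<or> k = 1 \<or> k = 2 \<or> k = 3 \<or> k = 4 \<or> k = 5" by auto
    \<comment> \<open>The same cancellation as for order 4, multiplied by
      \<open>J0 * q1\<close>.\<close>
    moreover have "32 / 81 * a3 + 250 / 567 * a4 + 1 / 14 * a5 = 0"
      by (simp add: a3_def a4_def a5_def a1_def a2_def field_simps)
    then have "J0 * (32 / 81 * a3 + 250 / 567 * a4 + 1 / 14 * a5) = 0" by simp
    \<comment> \<open>The coefficients of \<open>J0 * q3\<close>, \<open>J0^2 * q2\<close> and
      \<open>J0^3 * q1\<close> vanish one by one. \<open>J0 * J1 * q1\<close> arises with -1/160
      from the terms J0 b_i and with 1/160 from the terms c_i J1 a_i; merging them uses that scalars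
      commute.\<close>
    moreover have "32 / 81 * (J0 * b3 + ?c 3 * J1 * a3) + 250 / 567 * (J0 * b4 + ?c 4 * J1 * a4)
        + 1 / 14 * (J0 * b5 + ?c 5 * J1 * a5) = 0"
      by (simp add: a3_def a4_def a5_def a1_def a2_def b1_def b2_def b3_def b4_def b5_def
          method_c_def field_simps)
    ultimately show "coeff (0 + pCons 0 (\<Sum>j<6. smult (method_b ! j) (s ! j))) k = coeff 0 k"
      by (auto simp: eval_nat_numeral lessThan_Suc method_b_def s_def s3_def s4_def s5_def
          algebra_simps)
  qed
  then show ?thesis by (simp add: taylor_upto_0_iff)
qed

end

section \<open>From error expansions to statements of order\<close>

lemma rk_stage_eq_rk_stage_vec:
  assumes "\<And>j. j < s \<Longrightarrow> (\<Sum>k<j. A ! j ! k) = c ! j" and "i < s"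
    and F: "\<And>v. F v 0 = f (v 0) (v 1)" "\<And>v. F v 1 = 1" and w: "w 0 = y0" "w 1 = x0"
  shows "rk_stage_vec A F w h i 0 = rk_stage A c f y0 x0 h i \<and>
    rk_stage_vec A F w h i 1 = x0 + c ! i * h"
  using \<open>i < s\<close>
proof (induction i rule: less_induct)
  case (less i)
  \<comment> \<open>The row sum advances the time component to exactly the node at which the
    non-autonomous scheme evaluates \<open>f\<close>.\<close>
  have "rk_stage_vec A F w h i 1 = x0 + c ! i * h"
    using assms(1)[OF less.prems]
    by (subst rk_stage_vec.simps) (simp add: F w mult.commute del: One_nat_def)
  moreover have "rk_stage_vec A F w h i 0 = rk_stage A c f y0 x0 h i"
    using less by (subst rk_stage_vec.simps, subst rk_stage.simps) (simp add: F w del: One_nat_def)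
  ultimately show ?case by simp
qed

lemma bigo_at_0I:
  fixes u :: "real \<Rightarrow> real"
  assumes "u \<in> O[nhds 0](\<lambda>h. h ^ n)"
  shows "u \<in> O[at 0](\<lambda>h. h ^ n)"
  using assms by (rule landau_o.big.filter_mono[rotated]) (simp add: at_within_def)

lemma rk_order_vector_method_4: "rk_order_vector method_A method_b 4"
  unfolding rk_order_vector_def
proof (intro allI impI, elim conjE)
  fix d :: nat and U f y0 x0 y \<epsilon>
  assume d: "1 \<le> d" and U: "openin (Euclidean_space d) U"
    and range: "f \<in> U \<rightarrow> topspace (Euclidean_space d)"
    and smooth: "\<forall>m<d. Cinf_on d U (\<lambda>v. f v m)" and eps: "(0::real) < \<epsilon>" and y0: "y x0 = y0"
    and sol: "\<forall>x\<in>ball x0 \<epsilon>. y x \<in> U \<and>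
      (\<forall>m<d. ((\<lambda>t. y t m) has_real_derivative f (y x) m) (at x))"
  interpret autonomous_solution d U f y x0 \<epsilon>
    using d U range smooth eps sol by unfold_locales auto
  \<comment> \<open>The Euclidean norm is at most the sum of the absolute components, so
    componentwise estimates suffice.\<close>
  have "(\<lambda>h. L2_set (\<lambda>m. rk_step_vec method_A method_b f y0 h m - y (x0 + h) m) {..<d})
      \<in> O[nhds 0](\<lambda>h. \<Sum>m<d. \<bar>y (x0 + h) m - rk_step_vec method_A method_b f y0 h m\<bar>)"
  proof (intro bigoI[where c = 1] always_eventually allI)
    fix h
    show "norm (L2_set (\<lambda>m. rk_step_vec method_A method_b f y0 h m - y (x0 + h) m) {..<d})
        \<le> 1 * norm (\<Sum>m<d. \<bar>y (x0 + h) m - rk_step_vec method_A method_b f y0 h m\<bar>)"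
      using L2_set_le_sum_abs[of "\<lambda>m. rk_step_vec method_A method_b f y0 h m - y (x0 + h) m" "{..<d}"]
      by (simp add: abs_minus_commute sum_nonneg)
  qed
  also have "(\<lambda>h. \<Sum>m<d. \<bar>y (x0 + h) m - rk_step_vec method_A method_b f y0 h m\<bar>)
      \<in> O[nhds 0](\<lambda>h. h ^ 5)"
    using method_step_error_order4 by (intro big_sum_in_bigo) (simp add: y0)
  finally show "(\<lambda>h. L2_set (\<lambda>m. rk_step_vec method_A method_b f y0 h m - y (x0 + h) m) {..<d})
      \<in> O[at 0](\<lambda>h. h ^ (4 + 1))"
    by (simp add: bigo_at_0I)
qed

lemma Ck_on_const: "Ck_on d k U (\<lambda>_. a)"
proof (induction k arbitrary: a)
  case (Suc k)
  have "partial_deriv i (\<lambda>_. a) = (\<lambda>_. 0)" for i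
    by (simp add: partial_deriv_def fun_eq_iff)
  with Suc show ?case by simp
qed simp

lemma rk_order_scalar_method_5: "rk_order_scalar method_A method_b method_c 5"
  unfolding rk_order_scalar_def
proof (intro allI impI, elim conjE)
  fix U :: "(real \<times> real) set" and f y0 x0 y \<epsilon>
  assume U: "open U"
    and smooth: "Cinf_on 2 {v \<in> topspace (Euclidean_space 2). (v 0, v 1) \<in> U} (\<lambda>v. f (v 0) (v 1))"
    and eps: "(0::real) < \<epsilon>" and y0: "y x0 = y0"
    and sol: "\<forall>x\<in>ball x0 \<epsilon>. (y x, x) \<in> U \<and> (y has_real_derivative f (y x) x) (at x)"
  define V where "V = {v \<in> topspace (Euclidean_space 2). (v 0, v 1) \<in> U}"
  \<comment> \<open>Autonomous form: time is adjoined as component 1 with derivative 1, and the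
    zeros beyond keep the values in R^2.\<close>
  define F :: "(nat \<Rightarrow> real) \<Rightarrow> nat \<Rightarrow> real"
    where "F v m = (if m = 0 then f (v 0) (v 1) else if m = 1 then 1 else 0)" for v m
  define w :: "real \<Rightarrow> nat \<Rightarrow> real"
    where "w t m = (if m = 0 then y t else if m = 1 then t else 0)" for t m
  have "continuous_on UNIV (\<lambda>v::nat \<Rightarrow> real. (v 0, v 1))"
    by (intro continuous_on_Pair continuous_on_product_coordinates)
  then have "open ((\<lambda>v::nat \<Rightarrow> real. (v 0, v 1)) -` U)"
    using U by (simp add: continuous_on_open_vimage)
  then have open_V: "openin (Euclidean_space 2) V"
    unfolding Euclidean_space_def openin_subtopology V_def topspace_Euclidean_space
    by (intro exI[of _ "(\<lambda>v. (v 0, v 1)) -` U"]) (auto simp: euclidean_product_topology)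
  interpret autonomous_solution 2 V F w x0 \<epsilon>
  proof
    show "F \<in> V \<rightarrow> topspace (Euclidean_space 2)"
      by (auto simp: F_def topspace_Euclidean_space)
    show "Cinf_on 2 V (\<lambda>v. F v m)" if "m < 2" for m
      using smooth Ck_on_const that by (cases "m = 0") (auto simp: F_def V_def Cinf_on_def)
    show "w x \<in> V" if "x \<in> ball x0 \<epsilon>" for x
      using sol that by (auto simp: w_def V_def topspace_Euclidean_space)
    show "((\<lambda>t. w t m) has_real_derivative F (w x) m) (at x)" if "x \<in> ball x0 \<epsilon>" "m < 2" for x m
      using sol that by (cases "m = 0") (auto simp: w_def F_def)
  qed (use eps open_V in auto)
  have "(\<lambda>h. w (x0 + h) 0 - rk_step_vec method_A method_b F (w x0) h 0) \<in> O[nhds 0](\<lambda>h. h ^ 6)"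
    by (rule method_step_error_order5) (auto simp: F_def w_def)
  moreover have "rk_step_vec method_A method_b F (w x0) h 0 = rk_step method_A method_b method_c f y0 x0 h"
    for h
  proof -
    have "rk_stage_vec method_A F (w x0) h i 0 = rk_stage method_A method_c f y0 x0 h i \<and>
        rk_stage_vec method_A F (w x0) h i 1 = x0 + method_c ! i * h" if "i < 6" for i
      by (rule rk_stage_eq_rk_stage_vec[where s = 6])
        (use that method_row_sum y0 in \<open>auto simp: F_def w_def\<close>)
    then have "F (rk_stage_vec method_A F (w x0) h i) 0
        = f (rk_stage method_A method_c f y0 x0 h i) (x0 + method_c ! i * h)" if "i < 6" for i
      using that by (simp add: F_def)
    then show ?thesis
      by (simp add: rk_step_vec_def rk_step_def length_method_b w_def y0)
  qed
  ultimately have "(\<lambda>h. y (x0 + h) - rk_step method_A method_b method_c f y0 x0 h) \<in> O[nhds 0](\<lambda>h. h ^ 6)"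
    by (simp add: w_def)
  then have "(\<lambda>h. - (y (x0 + h) - rk_step method_A method_b method_c f y0 x0 h)) \<in> O[nhds 0](\<lambda>h. h ^ 6)"
    by (simp only: landau_o.big.uminus_in_iff)
  then show "(\<lambda>h. rk_step method_A method_b method_c f y0 x0 h - y (x0 + h)) \<in> O[at 0](\<lambda>h. h ^ (5 + 1))"
    by (simp add: bigo_at_0I)
qed

section \<open>A polynomial system on which order 5 fails\<close>

lemma Ck_on_coordinate: "Ck_on d k U (\<lambda>v. v a)"
proof -
  have "partial_deriv i (\<lambda>v. v a) = (\<lambda>_. if i = a then 1 else 0)" for i
    by (auto simp: partial_deriv_def fun_eq_iff)
  moreover have "continuous_on U (\<lambda>v. v a :: real)"
    by (rule continuous_on_subset[OF continuous_on_product_coordinates subset_UNIV])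
  moreover have "(\<lambda>t. (v(i := t)) a) field_differentiable (at (v i))" for i and v :: "nat \<Rightarrow> real"
    by (cases "i = a") auto
  ultimately show ?thesis by (cases k) (simp_all add: Ck_on_const)
qed

text \<open>For distinct indices each partial derivative is a coordinate or 0, which reduces the
  claim to the previous cases.\<close>

lemma Ck_on_coordinate_mult:
  assumes "a \<noteq> b"
  shows "Ck_on d k U (\<lambda>v. v a * v b)"
proof -
  have "partial_deriv i (\<lambda>v. v a * v b) =
      (if i = a then (\<lambda>v. v b) else if i = b then (\<lambda>v. v a) else (\<lambda>_. 0))" for i
    using assms by (auto simp: partial_deriv_def fun_eq_iff intro!: DERIV_imp_deriv derivative_eq_intros)
  moreover have "continuous_on U (\<lambda>v. v a * v b :: real)"
    by (intro continuous_on_mult continuous_on_subset[OF continuous_on_product_coordinates subset_UNIV])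
  moreover have "(\<lambda>t. (v(i := t)) a * (v(i := t)) b) field_differentiable (at (v i))"
    for i and v :: "nat \<Rightarrow> real"
    using assms by (cases "i = a"; cases "i = b") (auto intro!: derivative_intros)
  ultimately show ?thesis by (cases k) (simp_all add: Ck_on_const Ck_on_coordinate)
qed

text \<open>In \<open>y\<^sub>0' = 1\<close>, \<open>y\<^sub>1' = y\<^sub>0\<close>, \<open>y\<^sub>2' = y\<^sub>0 y\<^sub>1\<close>, \<open>y\<^sub>3' = y\<^sub>2\<close> the last component isolates the order
  condition \<open>\<Sum> b\<^sub>i a\<^sub>i\<^sub>j c\<^sub>j a\<^sub>j\<^sub>k c\<^sub>k = 1/40\<close>, which the method violates.\<close>

lemma not_rk_order_vector_method_5: "\<not> rk_order_vector method_A method_b 5"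
proof
  assume order: "rk_order_vector method_A method_b 5"
  define f :: "(nat \<Rightarrow> real) \<Rightarrow> nat \<Rightarrow> real" where
    "f v m = (if m = 0 then 1 else if m = 1 then v 0 else if m = 2 then v 0 * v 1
      else if m = 3 then v 2 else 0)" for v m
  define y :: "real \<Rightarrow> nat \<Rightarrow> real" where
    "y t m = (if m = 0 then t else if m = 1 then t ^ 2 / 2 else if m = 2 then t ^ 4 / 8
      else if m = 3 then t ^ 5 / 40 else 0)" for t m
  define y0 :: "nat \<Rightarrow> real" where "y0 m = 0" for m
  have f: "f v 0 = 1" "f v (Suc 0) = v 0" "f v 2 = v 0 * v (Suc 0)" "f v 3 = v 2" for v
    by (auto simp: f_def)
  have stage: "rk_stage_vec method_A f y0 h i 2 = h ^ 4 *
      (\<Sum>j<i. method_A ! i ! j * (method_node j * (\<Sum>k<j. method_A ! j ! k * method_node k)))"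
    if i: "i < 6" for h i
  proof -
    \<comment> \<open>With zero initial values, components 0 and 1 of the stages are monomials in
      \<open>h\<close>; their product yields component 2 in closed form, without remainder.\<close>
    have 0: "rk_stage_vec method_A f y0 h j 0 = h * method_node j" if "j < 6" for j
      using method_row_sum[OF that] by (subst rk_stage_vec.simps) (simp add: f y0_def)
    have 1: "rk_stage_vec method_A f y0 h j (Suc 0) = h * h * (\<Sum>k<j. method_A ! j ! k * method_node k)"
      if "j < 6" for j
      using that by (subst rk_stage_vec.simps)
        (simp add: f y0_def 0 sum_distrib_left mult_ac)
    have 4: "h ^ 4 = h * (h * (h * h))" by (simp add: eval_nat_numeral)
    show ?thesis
      using i unfolding 4 by (subst rk_stage_vec.simps)
        (simp add: f y0_def 0 1 sum_distrib_left mult_ac)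
  qed
  \<comment> \<open>The method gives h^5/32 where the solution has h^5/40, and 1/32 - 1/40 =
    1/160.\<close>
  have step: "rk_step_vec method_A method_b f y0 h 3 - y h 3 = h ^ 5 * (1 / 160)" for h
  proof -
    have 5: "h ^ 5 = h * h ^ 4" by (simp add: eval_nat_numeral)
    have "rk_step_vec method_A method_b f y0 h 3 = h * (\<Sum>i<6. method_b ! i * (h ^ 4 *
      (\<Sum>j<i. method_A ! i ! j * (method_node j * (\<Sum>k<j. method_A ! j ! k * method_node k)))))"
      by (simp add: rk_step_vec_def length_method_b y0_def f stage)
    also have "\<dots> = h ^ 5 * (\<Sum>i<6. method_b ! i *
      (\<Sum>j<i. method_A ! i ! j * (method_node j * (\<Sum>k<j. method_A ! j ! k * method_node k))))"
      unfolding 5 by (simp add: sum_distrib_left mult_ac)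
    also have "(\<Sum>i<6. method_b ! i *
      (\<Sum>j<i. method_A ! i ! j * (method_node j * (\<Sum>k<j. method_A ! j ! k * method_node k)))) = 1 / 32"
      by (simp add: eval_nat_numeral lessThan_Suc method_A_def method_b_def method_c_def)
    finally show ?thesis by (simp add: y_def)
  qed
  have "(\<lambda>h. L2_set (\<lambda>m. rk_step_vec method_A method_b f y0 h m - y (0 + h) m) {..<4})
      \<in> O[at 0](\<lambda>h. h ^ (5 + 1))"
  proof (rule order[unfolded rk_order_vector_def, rule_format,
        where U = "topspace (Euclidean_space 4)" and f = f and ?y0.0 = y0 and \<epsilon> = 1], goal_cases)
    case 2
    have smooth: "Cinf_on 4 (topspace (Euclidean_space 4)) (\<lambda>v. f v m)" if "m < 4" for m
    proof -
      have "m = 0 \<or> m = 1 \<or> m = 2 \<or> m = 3" using that by auto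
      then show ?thesis
        by (auto simp: f Cinf_on_def Ck_on_const Ck_on_coordinate Ck_on_coordinate_mult)
    qed
    have sol: "((\<lambda>t. y t m) has_real_derivative f (y x) m) (at x)" if "m < 4" for m x
    proof -
      have pow: "((\<lambda>t. t ^ n / c) has_real_derivative real n * x ^ (n - 1) / c) (at x)" for n c
        using DERIV_cdivide[OF DERIV_pow[of n x]] by simp
      have "x * (x ^ 2 / 2) = 4 * x ^ 3 / 8" by (simp add: eval_nat_numeral)
      moreover have "m = 0 \<or> m = 1 \<or> m = 2 \<or> m = 3" using that by auto
      ultimately show ?thesis
        using pow[of 2 2] pow[of 4 8] pow[of 5 40] by (auto simp: f y_def)
    qed
    have "f \<in> topspace (Euclidean_space 4) \<rightarrow> topspace (Euclidean_space 4)"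
      "y x \<in> topspace (Euclidean_space 4)" "y0 \<in> topspace (Euclidean_space 4)" "y 0 = y0" for x
      by (auto simp: topspace_Euclidean_space y_def y0_def f_def)
    with smooth sol show ?case by simp
  qed simp
  then obtain C where C: "C > 0" and "eventually (\<lambda>h. norm (L2_set
      (\<lambda>m. rk_step_vec method_A method_b f y0 h m - y (0 + h) m) {..<4}) \<le> C * norm (h ^ (5 + 1))) (at 0)"
    by (rule landau_o.bigE)
  then obtain \<delta> where \<delta>: "\<delta> > 0" "\<And>h. h \<noteq> 0 \<Longrightarrow> \<bar>h\<bar> < \<delta> \<Longrightarrow>
      L2_set (\<lambda>m. rk_step_vec method_A method_b f y0 h m - y h m) {..<4} \<le> C * \<bar>h\<bar> ^ 6"
    by (auto simp: eventually_at dist_real_def power_abs abs_mult)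
  \<comment> \<open>The first bound stays within \<open>\<delta>\<close>; the second makes
    \<open>C * h\<close> at most 1/320, half the exact error constant 1/160.\<close>
  define h where "h = min (\<delta> / 2) (1 / (320 * C))"
  have h: "0 < h" "h < \<delta>" "C * h \<le> 1 / 320"
    using \<delta>(1) C by (auto simp: h_def min_def field_simps)
  have "h ^ 5 * (1 / 160) = \<bar>rk_step_vec method_A method_b f y0 h 3 - y h 3\<bar>"
    using h(1) by (simp add: step abs_mult)
  also have "\<dots> \<le> L2_set (\<lambda>m. \<bar>rk_step_vec method_A method_b f y0 h m - y h m\<bar>) {..<4}"
    by (rule member_le_L2_set) auto
  also have "\<dots> = L2_set (\<lambda>m. rk_step_vec method_A method_b f y0 h m - y h m) {..<4}"
    by (simp add: L2_set_def)
  also have "\<dots> \<le> C * \<bar>h\<bar> ^ 6" using \<delta>(2) h by simp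
  also have "\<dots> = h ^ 5 * (C * h)" using h(1) by (simp add: eval_nat_numeral)
  also have "\<dots> \<le> h ^ 5 * (1 / 320)" using h by (intro mult_left_mono) auto
  finally show False using h(1) by simp
qed

theorem mainTheorem3:
  shows "rk_order_scalar method_A method_b method_c 5 \<and>
         rk_order_vector method_A method_b 4 \<and>
         \<not> rk_order_vector method_A method_b 5"
  using rk_order_scalar_method_5 rk_order_vector_method_4 not_rk_order_vector_method_5 by blast

end
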